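(* Let $\star\in\{\mathsf T,\mathsf H\}$, let $n,r\ge1$, and let $A_k,B_k,C_k,D_k,E_k\in\mathbb{C}^{n\times n}$ for $k=1,\dots,r$. The system $$\left\{\begin{array}{ll} A_kX_kB_k-C_kX_{k+1}D_k=E_k, & k=1,\dots,r-1,\\ A_rX_rB_r-C_rX_1^\star D_r=E_r,\end{array}\right.$$ in the unknowns $X_1,\dots,X_r\in\mathbb{C}^{n\times n}$, is nonsingular if and only if the $(2rn)\times(2rn)$ matrix pencil $$\mathcal Q(\lambda)=\begin{bmatrix}\lambda A_1& C_1\\ &\ddots&\ddots\\ &&\lambda A_r& C_r\\ &&&\lambda B_1^\star& D_1^\star\\ &&&&\ddots&\ddots\\ &&&&&\ddots& D_{r-1}^\star\\ -D_r^\star&&&&&&\lambda B_r^\star\end{bmatrix}$$ is regular and: - if $\star=\mathsf H$, then $\Lambda(\mathcal Q)$ is $\mathsf H$-reciprocal free; - if $\star=\mathsf T$, then $\Lambda(\mathcal Q)\setminus\mathfrak R_{2r}$ is reciprocal free and the multiplicity of $\xi$ as an eigenvalue of $\mathcal Q$, for any $\xi\in\mathfrak R_{2r}$, is at most $1$.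
   Context: $\mathsf T$ denotes transpose and $\mathsf H$ conjugate transpose. A system of matrix equations is called nonsingular if it has a unique solution for every choice of the right-hand sides $E_1,\dots,E_r$. The pencil $\mathcal Q(\lambda)$ is a $2r\times 2r$ block matrix with $n\times n$ blocks: its diagonal blocks are $\lambda A_1,\dots,\lambda A_r,\lambda B_1^\star,\dots,\lambda B_r^\star$, its superdiagonal blocks are $C_1,\dots,C_r,D_1^\star,\dots,D_{r-1}^\star$, its bottom-left block is $-D_r^\star$, and all other blocks are zero. A square pencil $\mathcal Q(\lambda)$ is regular if $\det\mathcal Q(\lambda)$ is not identically zero. The spectrum $\Lambda(\mathcal Q)$ of a regular pencil is the set of $\lambda$ for which $\mathcal Q(\lambda)$ is singular, including $\infty$ if the degree of $\det\mathcal Q(\lambda)$ is smaller than the size of the pencil; the multiplicity of a finite eigenvalue is its multiplicity as a root of $\det\mathcal Q(\lambda)$. $\mathfrak R_p=\{e^{2\pi \mathrm{i}j/p}: j=0,1,\dots,p-1\}$ is the set of $p$-th roots of unity. A set $\mathcal S\subseteq\mathbb{C}\cup\{\infty\}$ is reciprocal free if $\lambda\ne\mu^{-1}$ for all $\lambda,\mu\in\mathcal S$ (including $\lambda=\mu$), and $\mathsf H$-reciprocal free if $\lambda\ne(\overline\mu)^{-1}$ for all $\lambda,\mu\in\mathcal S$ (including $\lambda=\mu$), with the conventions $0^{-1}=\infty$, $\infty^{-1}=0$, $\overline\infty=\infty$. *)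

theory Defs
  imports
    "HOL-Library.FuncSet"
    "HOL-Computational_Algebra.Polynomial"
    "Jordan_Normal_Form.Determinant"
    "Jordan_Normal_Form.Schur_Decomposition"
begin

datatype star_kind = Transp | ConjTransp

fun star_mat :: "star_kind \<Rightarrow> complex mat \<Rightarrow> complex mat" where
  "star_mat Transp M = transpose_mat M"
| "star_mat ConjTransp M = mat_adjoint M"

text \<open>The unknowns and the right-hand sides are families indexed by \<open>{1..r}\<close>. Families of unknowns
  are taken in the extensional function space, so that uniqueness is not affected by the values at
  indices outside of \<open>{1..r}\<close>.\<close>

definition solves_system ::
  "star_kind \<Rightarrow> nat \<Rightarrow> (nat \<Rightarrow> complex mat) \<Rightarrow> (nat \<Rightarrow> complex mat) \<Rightarrow> (nat \<Rightarrow> complex mat) \<Rightarrow>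
   (nat \<Rightarrow> complex mat) \<Rightarrow> (nat \<Rightarrow> complex mat) \<Rightarrow> (nat \<Rightarrow> complex mat) \<Rightarrow> bool" where
  "solves_system s r A B C D E X \<longleftrightarrow>
     (\<forall>k\<in>{1..<r}. A k * X k * B k - C k * X (k + 1) * D k = E k) \<and>
     A r * X r * B r - C r * star_mat s (X 1) * D r = E r"

definition nonsingular_system ::
  "star_kind \<Rightarrow> nat \<Rightarrow> nat \<Rightarrow> (nat \<Rightarrow> complex mat) \<Rightarrow> (nat \<Rightarrow> complex mat) \<Rightarrow>
   (nat \<Rightarrow> complex mat) \<Rightarrow> (nat \<Rightarrow> complex mat) \<Rightarrow> bool" where
  "nonsingular_system s n r A B C D \<longleftrightarrow>
     (\<forall>E \<in> {1..r} \<rightarrow> carrier_mat n n.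
        \<exists>!X. X \<in> {1..r} \<rightarrow>\<^sub>E carrier_mat n n \<and> solves_system s r A B C D E X)"

text \<open>\<open>block_matrix m n F\<close> consists of \<open>m \<times> m\<close> blocks of size \<open>n \<times> n\<close>; the block indices run from
  \<open>1\<close> to \<open>m\<close>, whereas the entries of matrices are indexed from \<open>0\<close>.\<close>

definition block_matrix :: "nat \<Rightarrow> nat \<Rightarrow> (nat \<Rightarrow> nat \<Rightarrow> 'a mat) \<Rightarrow> 'a mat" where
  "block_matrix m n F =
     mat (m * n) (m * n) (\<lambda>(i, j). F (i div n + 1) (j div n + 1) $$ (i mod n, j mod n))"

text \<open>A matrix pencil is a matrix over the polynomials in \<open>\<lambda>\<close>, with \<open>\<lambda> = [:0, 1:]\<close>.\<close>

definition const_mat :: "complex mat \<Rightarrow> complex poly mat" where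
  "const_mat M = map_mat (\<lambda>a. [:a:]) M"

definition lambda_mat :: "complex mat \<Rightarrow> complex poly mat" where
  "lambda_mat M = [:0, 1:] \<cdot>\<^sub>m const_mat M"

definition pencil_Q ::
  "star_kind \<Rightarrow> nat \<Rightarrow> nat \<Rightarrow> (nat \<Rightarrow> complex mat) \<Rightarrow> (nat \<Rightarrow> complex mat) \<Rightarrow>
   (nat \<Rightarrow> complex mat) \<Rightarrow> (nat \<Rightarrow> complex mat) \<Rightarrow> complex poly mat" where
  "pencil_Q s n r A B C D = block_matrix (2 * r) n (\<lambda>k l.
     if l = k then
       (if k \<le> r then lambda_mat (A k) else lambda_mat (star_mat s (B (k - r))))
     else if l = k + 1 then
       (if k \<le> r then const_mat (C k) else const_mat (star_mat s (D (k - r))))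
     else if k = 2 * r \<and> l = 1 then - const_mat (star_mat s (D r))
     else 0\<^sub>m n n)"

definition regular_pencil :: "complex poly mat \<Rightarrow> bool" where
  "regular_pencil Q \<longleftrightarrow> square_mat Q \<and> det Q \<noteq> 0"

definition eval_pencil :: "complex poly mat \<Rightarrow> complex \<Rightarrow> complex mat" where
  "eval_pencil Q z = map_mat (\<lambda>p. poly p z) Q"

datatype ext_complex = Fin complex | Infty

fun ext_inverse :: "ext_complex \<Rightarrow> ext_complex" where
  "ext_inverse (Fin z) = (if z = 0 then Infty else Fin (inverse z))"
| "ext_inverse Infty = Fin 0"

fun ext_cnj :: "ext_complex \<Rightarrow> ext_complex" where
  "ext_cnj (Fin z) = Fin (cnj z)"
| "ext_cnj Infty = Infty"

definition pencil_spectrum :: "complex poly mat \<Rightarrow> ext_complex set" where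
  "pencil_spectrum Q =
     {Fin z | z. \<not> invertible_mat (eval_pencil Q z)} \<union>
     (if degree (det Q) < dim_row Q then {Infty} else {})"

definition eigenvalue_mult :: "complex poly mat \<Rightarrow> complex \<Rightarrow> nat" where
  "eigenvalue_mult Q z = order z (det Q)"

definition roots_unity :: "nat \<Rightarrow> complex set" where
  "roots_unity p = {exp (2 * of_real pi * \<i> * of_nat j / of_nat p) | j. j < p}"

definition reciprocal_free :: "ext_complex set \<Rightarrow> bool" where
  "reciprocal_free S \<longleftrightarrow> (\<forall>x\<in>S. \<forall>y\<in>S. x \<noteq> ext_inverse y)"

definition H_reciprocal_free :: "ext_complex set \<Rightarrow> bool" where
  "H_reciprocal_free S \<longleftrightarrow> (\<forall>x\<in>S. \<forall>y\<in>S. x \<noteq> ext_inverse (ext_cnj y))"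

end

theory Submission
  imports Defs "Jordan_Normal_Form.Spectral_Radius"
begin

text \<open>The idea is to reduce to scalar systems, on which both sides of the equivalence can be read off.

Applying \<open>\<star>\<close> to the \<open>k\<close>-th equation gives an equation for \<open>X\<^sub>k\<^sup>\<star>\<close>
and \<open>X\<^sub>k\<^sub>+\<^sub>1\<^sup>\<star>\<close>. Appending these equations closes the system up into a cycle of
length \<open>2r\<close>: with the \<open>2r\<close>-periodic coefficients \<open>L = (A\<^sub>1, \<dots>, A\<^sub>r, B\<^sub>1\<^sup>\<star>, \<dots>, B\<^sub>r\<^sup>\<star>)\<close>
and \<open>R = (C\<^sub>1, \<dots>, C\<^sub>r, D\<^sub>1\<^sup>\<star>, \<dots>, D\<^sub>r\<^sup>\<star>)\<close> it reads
\<open>L\<^sub>k Y\<^sub>k L\<^sub>k\<^sub>+\<^sub>r\<^sup>\<star> - R\<^sub>k Y\<^sub>k\<^sub>+\<^sub>1 R\<^sub>k\<^sub>+\<^sub>r\<^sup>\<star> = E\<^sub>k\<close> for families with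
\<open>Y\<^sub>k\<^sub>+\<^sub>r = Y\<^sub>k\<^sup>\<star>\<close> (\<open>nonsingular_system_iff_doubled\<close>). The pencil is built from the same two
families.

The periodic Schur form (\<open>periodic_Schur_form\<close>) provides invertible \<open>Q\<^sub>k\<close>, \<open>Z\<^sub>k\<close> such that all
\<open>Q\<^sub>k L\<^sub>k Z\<^sub>k\<close> and \<open>Q\<^sub>k R\<^sub>k Z\<^sub>k\<^sub>+\<^sub>1\<close> are upper triangular. This change of coordinates preserves
unique solvability (\<open>equivalence_invariance\<close>) and multiplies the determinant of the pencil by a nonzero
constant (\<open>det_cyclic_pencil_equivalence\<close>), so that the coefficients may be taken triangular. Let
\<open>\<alpha>\<^sub>i\<close> and \<open>\<gamma>\<^sub>i\<close> be the products over \<open>k < 2r\<close> of the \<open>i\<close>-th diagonal entries of \<open>L\<^sub>k\<close> and \<open>R\<^sub>k\<close>.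

For triangular coefficients the system is solved by back substitution: the entries \<open>(i, j)\<close> and \<open>(j, i)\<close> of
the unknowns satisfy a scalar cyclic system whose right-hand side depends on entries \<open>(a, b)\<close> with
\<open>a + b > i + j\<close> only. For \<open>i \<noteq> j\<close> that cycle has length \<open>2r\<close> and is uniquely solvable iff
\<open>\<alpha>\<^sub>i \<alpha>\<^sub>j\<^sup>\<star> \<noteq> \<gamma>\<^sub>i \<gamma>\<^sub>j\<^sup>\<star>\<close>. For \<open>i = j\<close> it has length \<open>r\<close> and closes up with \<open>\<star>\<close>; it is uniquely
solvable iff \<open>\<alpha>\<^sub>i \<noteq> \<gamma>\<^sub>i\<close> in the transpose case, and iff \<open>|\<alpha>\<^sub>i| \<noteq> |\<gamma>\<^sub>i|\<close> in the conjugate transpose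
case. The system is nonsingular iff all of these scalar conditions hold
(\<open>doubled_nonsingular_iff_nondegenerate\<close>).

On the other side, reordering rows and columns turns the triangular pencil into a block triangular matrix
with \<open>n\<close> cyclic bidiagonal blocks, and its determinant is
\<open>\<Prod>\<^sub>i (\<alpha>\<^sub>i \<lambda>\<^sup>2\<^sup>r + \<gamma>\<^sub>i)\<close> (\<open>det_cyclic_pencil_triangular\<close>). The factors \<open>i\<close> and \<open>j\<close> contribute
eigenvalues that are reciprocal to each other iff \<open>\<alpha>\<^sub>i \<alpha>\<^sub>j\<^sup>\<star> = \<gamma>\<^sub>i \<gamma>\<^sub>j\<^sup>\<star>\<close>
(\<open>binomial_spectrum_reciprocal\<close>). In the conjugate transpose case this is the negation of the scalar
condition also for \<open>i = j\<close>. In the transpose case \<open>i = j\<close> gives \<open>\<alpha>\<^sub>i\<^sup>2 = \<gamma>\<^sub>i\<^sup>2\<close>, which allows the harmless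
possibility \<open>\<gamma>\<^sub>i = - \<alpha>\<^sub>i\<close>: then the eigenvalues are the \<open>2r\<close>-th roots of unity, which is why these are
exempt from the reciprocity condition; that no two distinct factors have this form is the condition on
multiplicities.\<close>

section \<open>Cyclic scalar systems\<close>

fun conj_by :: "star_kind \<Rightarrow> complex \<Rightarrow> complex" where
  "conj_by Transp z = z"
| "conj_by ConjTransp z = cnj z"

lemma conj_by_simps [simp]:
  "conj_by s (x + y) = conj_by s x + conj_by s y"
  "conj_by s (x - y) = conj_by s x - conj_by s y"
  "conj_by s (- x) = - conj_by s x"
  "conj_by s (x * y) = conj_by s x * conj_by s y"
  "conj_by s (x / y) = conj_by s x / conj_by s y"
  "conj_by s (x ^ m) = conj_by s x ^ m"
  "conj_by s 0 = 0" "conj_by s 1 = 1"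
  "conj_by s (conj_by s x) = x"
  "conj_by s x = 0 \<longleftrightarrow> x = 0"
  "conj_by s (inverse x) = inverse (conj_by s x)"
  by (cases s; simp)+

lemma conj_by_sum: "conj_by s (sum f A) = (\<Sum>x\<in>A. conj_by s (f x))"
  by (cases s) simp_all

lemma conj_by_prod: "conj_by s (prod f A) = (\<Prod>x\<in>A. conj_by s (f x))"
  by (cases s) simp_all

text \<open>This says that the twisted linear equation \<open>P x - Q x\<^sup>\<star> = e\<close>, to which a cyclic scalar system collapses,
has only the trivial solution for \<open>e = 0\<close>.\<close>
definition nondegenerate :: "star_kind \<Rightarrow> complex \<Rightarrow> complex \<Rightarrow> bool" where
  "nondegenerate s P Q \<longleftrightarrow> (\<forall>x. P * x = Q * conj_by s x \<longrightarrow> x = 0)"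

lemma nondegenerate_Transp: "nondegenerate Transp P Q \<longleftrightarrow> P \<noteq> Q"
  unfolding nondegenerate_def by (metis conj_by.simps(1) mult_cancel_right mult_1_right zero_neq_one)

text \<open>Eliminating the conjugate of \<open>x\<close> between the equation and its conjugate leaves
\<open>(|P|\<^sup>2 - |Q|\<^sup>2) x = 0\<close>. The moduli are written as products because the reciprocity of eigenvalues leads to
conditions of this form.\<close>
lemma nondegenerate_ConjTransp: "nondegenerate ConjTransp P Q \<longleftrightarrow> P * cnj P \<noteq> Q * cnj Q"
proof
  assume nd: "nondegenerate ConjTransp P Q"
  show "P * cnj P \<noteq> Q * cnj Q"
  proof
    assume eq: "P * cnj P = Q * cnj Q"
    \<comment> \<open>Two explicit solutions; both vanish only for \<open>P = Q = 0\<close>, when every number is a solution.\<close>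
    have "P * (Q + cnj P) = Q * cnj (Q + cnj P)"
      using eq by (simp add: algebra_simps)
    moreover have "P * (\<i> * (Q - cnj P)) = Q * cnj (\<i> * (Q - cnj P))"
      using eq by (simp add: algebra_simps)
    ultimately have "Q + cnj P = 0" "\<i> * (Q - cnj P) = 0"
      using nd unfolding nondegenerate_def by (metis conj_by.simps(2))+
    hence "Q + cnj P = 0" "Q - cnj P = 0" by simp_all
    hence "Q + Q = 0" by (metis add_diff_cancel_right' diff_0 eq_iff_diff_eq_0 minus_diff_eq)
    hence "Q = 0" "P = 0" using \<open>Q + cnj P = 0\<close> by auto
    hence "P * 1 = Q * conj_by ConjTransp 1" by simp
    thus False using nd unfolding nondegenerate_def by (metis zero_neq_one)
  qed
next
  assume ne: "P * cnj P \<noteq> Q * cnj Q"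
  show "nondegenerate ConjTransp P Q" unfolding nondegenerate_def
  proof (intro allI impI)
    fix x assume e: "P * x = Q * conj_by ConjTransp x"
    hence "cnj P * cnj x = cnj Q * x" by (metis complex_cnj_cnj complex_cnj_mult conj_by.simps(2))
    hence "(P * cnj P - Q * cnj Q) * (x * cnj x) = 0" using e by (simp add: algebra_simps)
    thus "x = 0" using ne by simp
  qed
qed

lemma nondegenerate_solvable:
  assumes "nondegenerate s P Q"
  shows "\<exists>x. P * x - Q * conj_by s x = e"
proof (cases s)
  case Transp
  hence "P \<noteq> Q" using assms nondegenerate_Transp by simp
  hence "(P - Q) * (e / (P - Q)) = e" by simp
  hence "P * (e / (P - Q)) - Q * (e / (P - Q)) = e" by (metis left_diff_distrib)
  thus ?thesis using Transp by (intro exI[of _ "e / (P - Q)"]) simp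
next
  case ConjTransp
  define d where "d = P * cnj P - Q * cnj Q"
  have d: "d \<noteq> 0" using assms nondegenerate_ConjTransp ConjTransp d_def by simp
  have dc: "cnj d = d" unfolding d_def by simp
  have "d * (P * ((cnj P * e + Q * cnj e) / d) - Q * cnj ((cnj P * e + Q * cnj e) / d))
      = P * (cnj P * e + Q * cnj e) - Q * (P * cnj e + cnj Q * e)"
    using d by (simp add: dc right_diff_distrib)
  also have "\<dots> = d * e" by (simp add: d_def algebra_simps)
  finally have "P * ((cnj P * e + Q * cnj e) / d) - Q * cnj ((cnj P * e + Q * cnj e) / d) = e"
    using d by simp
  thus ?thesis using ConjTransp by (intro exI[of _ "(cnj P * e + Q * cnj e) / d"]) simp
qed

text \<open>A system of \<open>m + 1\<close> cyclically linked equations, the last of which closes up with \<open>\<star>\<close>, is governed by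
the products of its coefficients. The induction eliminates the last unknown: the equations
\<open>p\<^sub>m u\<^sub>m - q\<^sub>m u\<^sub>m\<^sub>+\<^sub>1 = g\<^sub>m\<close> and \<open>p\<^sub>m\<^sub>+\<^sub>1 u\<^sub>m\<^sub>+\<^sub>1 - q\<^sub>m\<^sub>+\<^sub>1 u\<^sub>0\<^sup>\<star> = g\<^sub>m\<^sub>+\<^sub>1\<close> combine to one equation in \<open>u\<^sub>m\<close> and
\<open>u\<^sub>0\<^sup>\<star>\<close> whose coefficients are \<open>p\<^sub>m p\<^sub>m\<^sub>+\<^sub>1\<close> and \<open>q\<^sub>m q\<^sub>m\<^sub>+\<^sub>1\<close>, and \<open>u\<^sub>m\<^sub>+\<^sub>1\<close> can be recovered unless
\<open>p\<^sub>m\<^sub>+\<^sub>1 = q\<^sub>m = 0\<close>. Solvability, uniqueness and the existence of a kernel are proved together because they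
share this step.\<close>
lemma cyclic_elimination:
  fixes s :: star_kind and p q :: "nat \<Rightarrow> complex"
  defines "sol \<equiv> \<lambda>m p q g u. (\<forall>k<m. p k * u k - q k * u (Suc k) = g k) \<and>
      p m * u m - q m * conj_by s (u 0) = (g m :: complex)"
  shows "(nondegenerate s (\<Prod>k\<le>m. p k) (\<Prod>k\<le>m. q k) \<longrightarrow>
            (\<forall>g. \<exists>u. sol m p q g u) \<and> (\<forall>u. sol m p q (\<lambda>_. 0) u \<longrightarrow> (\<forall>k\<le>m. u k = 0))) \<and>
         (\<not> nondegenerate s (\<Prod>k\<le>m. p k) (\<Prod>k\<le>m. q k) \<longrightarrow>
            (\<exists>u. sol m p q (\<lambda>_. 0) u \<and> (\<exists>k\<le>m. u k \<noteq> 0)))"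
proof (induction m arbitrary: p q)
  case 0
  show ?case
  proof (intro conjI impI allI)
    fix g :: "nat \<Rightarrow> complex" assume "nondegenerate s (\<Prod>k\<le>0. p k) (\<Prod>k\<le>0. q k)"
    then obtain x where "p 0 * x - q 0 * conj_by s x = g 0"
      using nondegenerate_solvable by fastforce
    thus "\<exists>u. sol 0 p q g u" unfolding sol_def by (intro exI[of _ "\<lambda>_. x"]) simp
  next
    fix u :: "nat \<Rightarrow> complex" and k :: nat
    assume "nondegenerate s (\<Prod>k\<le>0. p k) (\<Prod>k\<le>0. q k)" "sol 0 p q (\<lambda>_. 0) u" "k \<le> 0"
    thus "u k = 0" unfolding sol_def nondegenerate_def by simp
  next
    assume "\<not> nondegenerate s (\<Prod>k\<le>0. p k) (\<Prod>k\<le>0. q k)"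
    then obtain x where "p 0 * x = q 0 * conj_by s x" "x \<noteq> 0" unfolding nondegenerate_def by auto
    thus "\<exists>u. sol 0 p q (\<lambda>_. 0) u \<and> (\<exists>k\<le>0. u k \<noteq> 0)"
      unfolding sol_def by (intro exI[of _ "\<lambda>_. x"]) simp
  qed
next
  case (Suc m)
  define p' where "p' = p(m := p m * p (Suc m))"
  define q' where "q' = q(m := q m * q (Suc m))"
  have P: "(\<Prod>k\<le>m. p' k) = (\<Prod>k\<le>Suc m. p k)"
    by (simp add: p'_def lessThan_Suc_atMost[symmetric])
  have Q: "(\<Prod>k\<le>m. q' k) = (\<Prod>k\<le>Suc m. q k)"
    by (simp add: q'_def lessThan_Suc_atMost[symmetric])
  note IH = Suc.IH[of p' q', unfolded P Q]
  have lift: "sol (Suc m) p q g (u(Suc m := x))"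
    if "sol m p' q' (g(m := p (Suc m) * g m + q m * g (Suc m))) u"
      and x: "p (Suc m) * x = g (Suc m) + q (Suc m) * conj_by s (u 0)" "q m * x = p m * u m - g m"
    for g u x
    using that unfolding sol_def p'_def q'_def by (auto simp: less_Suc_eq)
  have lift_ex: "\<exists>x. sol (Suc m) p q g (u(Suc m := x))"
    if s: "sol m p' q' (g(m := p (Suc m) * g m + q m * g (Suc m))) u"
      and nz: "p (Suc m) \<noteq> 0 \<or> q m \<noteq> 0" for g u
  proof -
    have e: "p m * p (Suc m) * u m - q m * q (Suc m) * conj_by s (u 0) = p (Suc m) * g m + q m * g (Suc m)"
      using s unfolding sol_def p'_def q'_def by simp
    show ?thesis
    proof (cases "p (Suc m) = 0")
      case False
      define x where "x = (g (Suc m) + q (Suc m) * conj_by s (u 0)) / p (Suc m)"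
      have x1: "p (Suc m) * x = g (Suc m) + q (Suc m) * conj_by s (u 0)"
        using False by (simp add: x_def)
      have "p (Suc m) * (q m * x) = q m * (p (Suc m) * x)" by simp
      also have "\<dots> = p (Suc m) * (p m * u m - g m)" unfolding x1 using e by (simp add: algebra_simps)
      finally have "q m * x = p m * u m - g m" using False by simp
      with x1 show ?thesis using lift[OF s] by blast
    next
      case True
      hence q: "q m \<noteq> 0" using nz by simp
      define x where "x = (p m * u m - g m) / q m"
      have x1: "q m * x = p m * u m - g m" using q by (simp add: x_def)
      have "q m * (g (Suc m) + q (Suc m) * conj_by s (u 0)) = 0" using e True by (simp add: distrib_left eq_neg_iff_add_eq_0 [symmetric] mult.assoc)
      hence "p (Suc m) * x = g (Suc m) + q (Suc m) * conj_by s (u 0)" using q True by simp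
      with x1 show ?thesis using lift[OF s] by blast
    qed
  qed
  show ?case
  proof (intro conjI impI)
    assume nd: "nondegenerate s (\<Prod>k\<le>Suc m. p k) (\<Prod>k\<le>Suc m. q k)"
    have nz: "p (Suc m) \<noteq> 0 \<or> q m \<noteq> 0"
    proof (rule ccontr)
      assume "\<not> (p (Suc m) \<noteq> 0 \<or> q m \<noteq> 0)"
      hence "(\<Prod>k\<le>Suc m. p k) = 0" "(\<Prod>k\<le>Suc m. q k) = 0" by (auto simp: prod_zero_iff intro: le_SucI)
      thus False using nd unfolding nondegenerate_def by (metis mult_zero_left zero_neq_one)
    qed
    show "\<forall>g. \<exists>u. sol (Suc m) p q g u" using IH nd lift_ex nz by blast
    show "\<forall>u. sol (Suc m) p q (\<lambda>_. 0) u \<longrightarrow> (\<forall>k\<le>Suc m. u k = 0)"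
    proof (intro allI impI)
      fix u k assume s: "sol (Suc m) p q (\<lambda>_. 0) u" and k: "k \<le> Suc m"
      have e: "p m * u m = q m * u (Suc m)" "p (Suc m) * u (Suc m) = q (Suc m) * conj_by s (u 0)"
        using s unfolding sol_def by auto
      have "p m * p (Suc m) * u m = p (Suc m) * (p m * u m)" by simp
      also have "\<dots> = q m * (p (Suc m) * u (Suc m))" unfolding e(1) by simp
      also have "\<dots> = q m * q (Suc m) * conj_by s (u 0)" unfolding e(2) by simp
      finally have "sol m p' q' (\<lambda>_. 0) u" using s unfolding sol_def p'_def q'_def by auto
      hence z: "\<forall>k\<le>m. u k = 0" using IH nd by blast
      hence "u (Suc m) = 0" using e nz by auto
      thus "u k = 0" using z k by (cases "k = Suc m") auto
    qed
  next
    assume nd: "\<not> nondegenerate s (\<Prod>k\<le>Suc m. p k) (\<Prod>k\<le>Suc m. q k)"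
    show "\<exists>u. sol (Suc m) p q (\<lambda>_. 0) u \<and> (\<exists>k\<le>Suc m. u k \<noteq> 0)"
    proof (cases "p (Suc m) \<noteq> 0 \<or> q m \<noteq> 0")
      case True
      obtain u k where u: "sol m p' q' (\<lambda>_. 0) u" and k: "k \<le> m" "u k \<noteq> 0" using IH nd by blast
      have "(\<lambda>_. 0)(m := p (Suc m) * 0 + q m * 0) = (\<lambda>_. 0::complex)" by auto
      with u lift_ex[OF _ True, of "\<lambda>_. 0" u] obtain x where "sol (Suc m) p q (\<lambda>_. 0) (u(Suc m := x))" by auto
      moreover have "(u(Suc m := x)) k \<noteq> 0" using k by simp
      ultimately show ?thesis using k(1) le_SucI by blast
    next
      case False
      \<comment> \<open>Both coefficients of the last unknown vanish, so it is free.\<close>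
      hence "sol (Suc m) p q (\<lambda>_. 0) ((\<lambda>_. 0)(Suc m := 1))" unfolding sol_def by (auto simp: less_Suc_eq)
      thus ?thesis by (intro exI[of _ "(\<lambda>_. 0)(Suc m := 1)"]) (auto intro!: exI[of _ "Suc m"])
    qed
  qed
qed

text \<open>Cyclic data are encoded as families over all natural numbers, so that shifts of the index need no
reduction modulo the period. With \<open>\<tau>\<close> the identity this is periodicity; with \<open>\<tau> = \<star>\<close> it is the
relation between a cycle of equations and its starred copy.\<close>
definition twisted_periodic :: "nat \<Rightarrow> ('a \<Rightarrow> 'a) \<Rightarrow> (nat \<Rightarrow> 'a) \<Rightarrow> bool" where
  "twisted_periodic m \<tau> f \<longleftrightarrow> (\<forall>k. f (k + m) = \<tau> (f k))"

lemma twisted_periodic_add_mult: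
  assumes "twisted_periodic m \<tau> f"
  shows "f (k + m * t) = (\<tau> ^^ t) (f k)"
proof (induction t)
  case (Suc t)
  have "f (k + m * Suc t) = f (k + m * t + m)" by (simp add: algebra_simps)
  also have "\<dots> = \<tau> (f (k + m * t))" using assms unfolding twisted_periodic_def by blast
  finally show ?case using Suc by simp
qed simp

lemma twisted_periodic_window:
  assumes "twisted_periodic m \<tau> f"
  shows "f k = (\<tau> ^^ (k div m)) (f (k mod m))"
  using twisted_periodic_add_mult[OF assms, of "k mod m" "k div m"] by simp

lemma twisted_periodic_eqI:
  assumes "twisted_periodic m \<tau> f" "twisted_periodic m \<tau> g" "m \<ge> 1" "\<And>k. k < m \<Longrightarrow> f k = g k"
  shows "f k = g k"
  using twisted_periodic_window[OF assms(1), of k] twisted_periodic_window[OF assms(2), of k] assms(3,4)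
  by simp

definition twisted_extension :: "nat \<Rightarrow> ('a \<Rightarrow> 'a) \<Rightarrow> (nat \<Rightarrow> 'a) \<Rightarrow> nat \<Rightarrow> 'a" where
  "twisted_extension m \<tau> f k = (\<tau> ^^ (k div m)) (f (k mod m))"

lemma twisted_periodic_extension: "m \<ge> 1 \<Longrightarrow> twisted_periodic m \<tau> (twisted_extension m \<tau> f)"
  unfolding twisted_periodic_def twisted_extension_def by simp

lemma twisted_extension_window [simp]: "k < m \<Longrightarrow> twisted_extension m \<tau> f k = f k"
  unfolding twisted_extension_def by simp

definition solves_cyclic ::
  "nat \<Rightarrow> star_kind \<Rightarrow> (nat \<Rightarrow> complex) \<Rightarrow> (nat \<Rightarrow> complex) \<Rightarrow> (nat \<Rightarrow> complex) \<Rightarrow> (nat \<Rightarrow> complex) \<Rightarrow> bool" where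
  "solves_cyclic m s p q g u \<longleftrightarrow> twisted_periodic m (conj_by s) u \<and> (\<forall>k. p k * u k - q k * u (Suc k) = g k)"

text \<open>Since both sides of the equations are twisted periodic, one period of equations suffices; the
last of them refers to \<open>u\<^sub>0\<^sup>\<star>\<close>. This connects periodic families with the finite systems of
\<open>cyclic_elimination\<close>.\<close>
lemma solves_cyclic_iff_window:
  assumes p: "twisted_periodic (Suc m) (conj_by s) p" and q: "twisted_periodic (Suc m) (conj_by s) q"
    and g: "twisted_periodic (Suc m) (conj_by s) g" and u: "twisted_periodic (Suc m) (conj_by s) u"
  shows "solves_cyclic (Suc m) s p q g u \<longleftrightarrow>
    (\<forall>k<m. p k * u k - q k * u (Suc k) = g k) \<and> p m * u m - q m * conj_by s (u 0) = g m"
    (is "_ \<longleftrightarrow> ?R")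
proof
  have um: "u (Suc m) = conj_by s (u 0)" using u unfolding twisted_periodic_def by (metis add_0)
  {
    assume "solves_cyclic (Suc m) s p q g u"
    thus ?R using um unfolding solves_cyclic_def by metis
  }
  assume R: ?R
  have l: "twisted_periodic (Suc m) (conj_by s) (\<lambda>k. p k * u k - q k * u (Suc k))"
    using p q u unfolding twisted_periodic_def by (metis add_Suc conj_by_simps(2,4))
  have "p k * u k - q k * u (Suc k) = g k" for k
    by (rule twisted_periodic_eqI[OF l g]) (use R um in \<open>auto simp: less_Suc_eq\<close>)
  thus "solves_cyclic (Suc m) s p q g u" using u unfolding solves_cyclic_def by blast
qed

lemma cyclic_system:
  assumes m: "m \<ge> 1" and p: "twisted_periodic m (conj_by s) p" and q: "twisted_periodic m (conj_by s) q"
  shows cyclic_solvable: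
      "\<lbrakk>nondegenerate s (\<Prod>k<m. p k) (\<Prod>k<m. q k); twisted_periodic m (conj_by s) g\<rbrakk>
        \<Longrightarrow> \<exists>u. solves_cyclic m s p q g u"
    and cyclic_unique:
      "\<lbrakk>nondegenerate s (\<Prod>k<m. p k) (\<Prod>k<m. q k); solves_cyclic m s p q (\<lambda>_. 0) u\<rbrakk>
        \<Longrightarrow> u k = 0"
    and cyclic_kernel:
      "\<not> nondegenerate s (\<Prod>k<m. p k) (\<Prod>k<m. q k)
        \<Longrightarrow> \<exists>u. solves_cyclic m s p q (\<lambda>_. 0) u \<and> (\<exists>k. u k \<noteq> 0)"
proof -
  obtain m' where m': "m = Suc m'" using m by (cases m) auto
  note el = cyclic_elimination[of s p m' q, folded lessThan_Suc_atMost m']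
  have tp0: "twisted_periodic m (conj_by s) (\<lambda>_. 0)" unfolding twisted_periodic_def by simp
  have ext: "solves_cyclic m s p q g (twisted_extension m (conj_by s) u)"
    if "twisted_periodic m (conj_by s) g"
      "(\<forall>k<m'. p k * u k - q k * u (Suc k) = g k) \<and> p m' * u m' - q m' * conj_by s (u 0) = g m'" for g u
    using that p q solves_cyclic_iff_window[of m' s p q g "twisted_extension m (conj_by s) u"]
      twisted_periodic_extension[OF m, of "conj_by s" u] unfolding m' by (simp add: twisted_extension_def)
  show "\<exists>u. solves_cyclic m s p q g u"
    if "nondegenerate s (\<Prod>k<m. p k) (\<Prod>k<m. q k)" "twisted_periodic m (conj_by s) g"
    using el that ext by blast
  show "\<exists>u. solves_cyclic m s p q (\<lambda>_. 0) u \<and> (\<exists>k. u k \<noteq> 0)"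
    if nd: "\<not> nondegenerate s (\<Prod>k<m. p k) (\<Prod>k<m. q k)"
  proof -
    obtain u k where u: "(\<forall>k<m'. p k * u k - q k * u (Suc k) = 0) \<and> p m' * u m' - q m' * conj_by s (u 0) = 0"
      and k: "k \<le> m'" "u k \<noteq> 0" using el nd by blast
    have "twisted_extension m (conj_by s) u k \<noteq> 0" using k m' by simp
    thus ?thesis using ext[OF tp0 u] by blast
  qed
  show "u k = 0"
    if nd: "nondegenerate s (\<Prod>k<m. p k) (\<Prod>k<m. q k)" and u: "solves_cyclic m s p q (\<lambda>_. 0) u" for u
  proof -
    have tu: "twisted_periodic m (conj_by s) u" using u unfolding solves_cyclic_def by blast
    have "\<forall>k\<le>m'. u k = 0" using el nd u solves_cyclic_iff_window[of m' s p q "\<lambda>_. 0" u] p q tp0 tu m' by auto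
    thus ?thesis using twisted_periodic_eqI[OF tu tp0 m] m' by auto
  qed
qed

section \<open>The star operation and the doubled system\<close>

lemma star_mat_carrier [simp]: "M \<in> carrier_mat n n \<Longrightarrow> star_mat s M \<in> carrier_mat n n"
  by (cases s) (auto simp: mat_adjoint_def)

lemma star_mat_dim [simp]: "dim_row (star_mat s M) = dim_col M" "dim_col (star_mat s M) = dim_row M"
  by (cases s; simp add: mat_adjoint_def)+

lemma star_mat_entry [simp]:
  "i < dim_col M \<Longrightarrow> j < dim_row M \<Longrightarrow> star_mat s M $$ (i, j) = conj_by s (M $$ (j, i))"
  by (cases s) (auto simp: mat_adjoint_def mat_of_rows_index)

lemma star_mat_index:
  "M \<in> carrier_mat n n \<Longrightarrow> i < n \<Longrightarrow> j < n \<Longrightarrow> star_mat s M $$ (i, j) = conj_by s (M $$ (j, i))"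
  by auto

lemma star_mat_star_mat [simp]: "star_mat s (star_mat s M) = M"
  by (rule eq_matI) auto

lemma square_carrier [simp]: "M \<in> carrier_mat n n \<Longrightarrow> M' \<in> carrier_mat n n \<Longrightarrow> M * M' \<in> carrier_mat n n"
  by (rule mult_carrier_mat)

lemma mult_mat_entry:
  fixes M M' :: "'a :: semiring_0 mat"
  assumes "M \<in> carrier_mat n n" "M' \<in> carrier_mat n n" "i < n" "j < n"
  shows "(M * M') $$ (i, j) = (\<Sum>a<n. M $$ (i, a) * M' $$ (a, j))"
  using assms by (simp add: scalar_prod_def lessThan_atLeast0)

lemma star_mat_mult:
  assumes "M \<in> carrier_mat n n" "M' \<in> carrier_mat n n"
  shows "star_mat s (M * M') = star_mat s M' * star_mat s M"
  by (rule eq_matI) (use assms star_mat_carrier[OF assms(1), of s] star_mat_carrier[OF assms(2), of s] in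
    \<open>auto simp: star_mat_index[of _ n] mult_mat_entry[of _ n] conj_by_sum mult.commute simp del: index_mult_mat(1)\<close>)

lemma star_mat_minus:
  assumes "M \<in> carrier_mat n n" "M' \<in> carrier_mat n n"
  shows "star_mat s (M - M') = star_mat s M - star_mat s M'"
  by (rule eq_matI) (use assms in auto)

lemma star_mat_one [simp]: "star_mat s (1\<^sub>m n) = 1\<^sub>m n"
  by (rule eq_matI) auto

text \<open>The unknowns and right-hand sides of the doubled system: \<open>Y\<^sub>k\<close> stands for \<open>X\<^sub>k\<^sub>+\<^sub>1\<close> when \<open>k < r\<close>, and
shifting the index by \<open>r\<close> applies \<open>\<star>\<close>, as in the last equation of the original system.\<close>
definition star_families :: "star_kind \<Rightarrow> nat \<Rightarrow> nat \<Rightarrow> (nat \<Rightarrow> complex mat) set" where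
  "star_families s n r = {Y. (\<forall>k. Y k \<in> carrier_mat n n) \<and> twisted_periodic r (star_mat s) Y}"

definition sylvester_map ::
  "star_kind \<Rightarrow> nat \<Rightarrow> (nat \<Rightarrow> complex mat) \<Rightarrow> (nat \<Rightarrow> complex mat) \<Rightarrow> (nat \<Rightarrow> complex mat) \<Rightarrow> nat \<Rightarrow> complex mat" where
  "sylvester_map s r L R Y k =
     L k * Y k * star_mat s (L (k + r)) - R k * Y (Suc k) * star_mat s (R (k + r))"

definition doubled_nonsingular ::
  "star_kind \<Rightarrow> nat \<Rightarrow> nat \<Rightarrow> (nat \<Rightarrow> complex mat) \<Rightarrow> (nat \<Rightarrow> complex mat) \<Rightarrow> bool" where
  "doubled_nonsingular s n r L R \<longleftrightarrow>
     (\<forall>E \<in> star_families s n r. \<exists>!Y. Y \<in> star_families s n r \<and> (\<forall>k. sylvester_map s r L R Y k = E k))"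

text \<open>Only the unknowns need to correspond bijectively. On the right-hand sides a relation that is total in
both directions is enough, which matters because the right-hand sides of the original system are not
extensional families.\<close>
lemma unique_solvability_transfer:
  assumes f: "bij_betw f S' S"
    and "\<And>E'. E' \<in> T' \<Longrightarrow> \<exists>E\<in>T. \<forall>X\<in>S'. rel E (f X) \<longleftrightarrow> rel' E' X"
    and "\<And>E. E \<in> T \<Longrightarrow> \<exists>E'\<in>T'. \<forall>X\<in>S'. rel E (f X) \<longleftrightarrow> rel' E' X"
  shows "(\<forall>E\<in>T. \<exists>!X. X \<in> S \<and> rel E X) \<longleftrightarrow> (\<forall>E'\<in>T'. \<exists>!X. X \<in> S' \<and> rel' E' X)"
proof -
  have tr: "(\<exists>!X. X \<in> S \<and> rel E X) \<longleftrightarrow> (\<exists>!X. X \<in> S' \<and> rel' E' X)"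
    if h: "\<forall>X\<in>S'. rel E (f X) \<longleftrightarrow> rel' E' X" for E E'
  proof
    assume "\<exists>!X. X \<in> S \<and> rel E X"
    then obtain X where X: "X \<in> S" "rel E X" "\<And>Y. Y \<in> S \<Longrightarrow> rel E Y \<Longrightarrow> Y = X" by blast
    obtain X' where X': "X' \<in> S'" "f X' = X" using X(1) f unfolding bij_betw_def by blast
    have "Y = X'" if "Y \<in> S'" "rel' E' Y" for Y
      using X(3)[of "f Y"] that h X' f unfolding bij_betw_def by (metis image_eqI inj_onD)
    thus "\<exists>!X. X \<in> S' \<and> rel' E' X" using X X' h by blast
  next
    assume "\<exists>!X. X \<in> S' \<and> rel' E' X"
    then obtain X where X: "X \<in> S'" "rel' E' X" "\<And>Y. Y \<in> S' \<Longrightarrow> rel' E' Y \<Longrightarrow> Y = X" by blast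
    have "Y = f X" if "Y \<in> S" "rel E Y" for Y
      using X(3) that h f unfolding bij_betw_def by blast
    thus "\<exists>!X. X \<in> S \<and> rel E X" using X h f unfolding bij_betw_def by blast
  qed
  show ?thesis
  proof (intro iffI ballI)
    fix E' assume all: "\<forall>E\<in>T. \<exists>!X. X \<in> S \<and> rel E X" and E': "E' \<in> T'"
    obtain E where E: "E \<in> T" and h: "\<forall>X\<in>S'. rel E (f X) \<longleftrightarrow> rel' E' X" using assms(2)[OF E'] by (elim bexE)
    show "\<exists>!X. X \<in> S' \<and> rel' E' X" using tr[OF h] all E by simp
  next
    fix E assume all: "\<forall>E'\<in>T'. \<exists>!X. X \<in> S' \<and> rel' E' X" and E: "E \<in> T"
    obtain E' where E': "E' \<in> T'" and h: "\<forall>X\<in>S'. rel E (f X) \<longleftrightarrow> rel' E' X" using assms(3)[OF E] by (elim bexE)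
    show "\<exists>!X. X \<in> S \<and> rel E X" using tr[OF h] all E' by simp
  qed
qed

text \<open>A \<open>2r\<close>-periodic pair of square coefficient families. The period is \<open>2r\<close> and not \<open>r\<close> because \<open>L\<^sub>k\<close> and
\<open>L\<^sub>k\<^sub>+\<^sub>r\<close> are unrelated: the former acts on \<open>Y\<^sub>k\<close> from the left, the star of the latter from the right.\<close>
locale cyclic_pair =
  fixes s :: star_kind and n r :: nat and L R :: "nat \<Rightarrow> complex mat"
  assumes r: "r \<ge> 1" and L [simp]: "\<And>k. L k \<in> carrier_mat n n" and R [simp]: "\<And>k. R k \<in> carrier_mat n n"
    and pL: "\<And>k. L (k + 2 * r) = L k" and pR: "\<And>k. R (k + 2 * r) = R k"
begin

abbreviation "SF \<equiv> star_families s n r"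
abbreviation "syl \<equiv> sylvester_map s r L R"
abbreviation "star \<equiv> star_mat s"

lemma L_shift_twice: "L (k + r + r) = L k" and R_shift_twice: "R (k + r + r) = R k"
  using pL[of k] pR[of k] by (simp_all add: mult_2 add.assoc)

lemma SF_carrier [simp]: "Y \<in> SF \<Longrightarrow> Y k \<in> carrier_mat n n"
  unfolding star_families_def by blast

lemma SF_shift: "Y \<in> SF \<Longrightarrow> Y (k + r) = star (Y k)"
  unfolding star_families_def twisted_periodic_def by blast

lemma SF_shift_Suc: "Y \<in> SF \<Longrightarrow> Y (Suc (k + r)) = star (Y (Suc k))"
  using SF_shift[of Y "Suc k"] by simp

lemma SF_shift_index: "Y \<in> SF \<Longrightarrow> i < n \<Longrightarrow> j < n \<Longrightarrow> Y (k + r) $$ (i, j) = conj_by s (Y k $$ (j, i))"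
  by (simp add: SF_shift star_mat_index[of _ n])

lemma SF_I:
  assumes "\<And>k. Y k \<in> carrier_mat n n"
    and "\<And>k i j. i < n \<Longrightarrow> j < n \<Longrightarrow> Y (k + r) $$ (i, j) = conj_by s (Y k $$ (j, i))"
  shows "Y \<in> SF"
proof -
  have "Y (k + r) = star (Y k)" for k
    by (rule eq_matI) (auto simp: assms(2) carrier_matD[OF assms(1)])
  thus ?thesis using assms unfolding star_families_def twisted_periodic_def by blast
qed

text \<open>The star of the \<open>k\<close>-th equation is the \<open>(k + r)\<close>-th equation, because \<open>\<star>\<close> reverses products and the
coefficients have period \<open>2r\<close>.\<close>
lemma syl_in_SF: assumes Y: "Y \<in> SF" shows "syl Y \<in> SF"
proof -
  have "syl Y (k + r) = star (syl Y k)" for k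
    using Y unfolding sylvester_map_def
    by (simp add: star_mat_minus[of _ n] star_mat_mult[of _ n] SF_shift SF_shift_Suc L_shift_twice R_shift_twice
        assoc_mult_mat[of _ n n _ n _ n])
  moreover have "syl Y k \<in> carrier_mat n n" for k
    using Y unfolding sylvester_map_def by (intro minus_carrier_mat) simp
  ultimately show ?thesis unfolding star_families_def twisted_periodic_def by blast
qed

lemma congruence_bij:
  assumes Z: "\<And>k. Z k \<in> carrier_mat n n" "\<And>k. Zi k \<in> carrier_mat n n"
    and inv: "\<And>k. Zi k * Z k = 1\<^sub>m n" "\<And>k. Z k * Zi k = 1\<^sub>m n"
    and p: "\<And>k. Z (k + 2 * r) = Z k"  "\<And>k. Zi (k + 2 * r) = Zi k"
  shows "bij_betw (\<lambda>Y k. Zi k * Y k * star (Zi (k + r))) SF SF"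
proof -
  have into: "(\<lambda>k. M k * Y k * star (M (k + r))) \<in> SF"
    if Y: "Y \<in> SF" and M: "\<And>k. M k \<in> carrier_mat n n" and pM: "\<And>k. M (k + 2 * r) = M k" for M Y
  proof -
    have "M (k + r + r) = M k" for k using pM[of k] by (simp add: mult_2 add.assoc)
    thus ?thesis using Y M unfolding star_families_def twisted_periodic_def
      by (auto simp: star_mat_mult[of _ n] assoc_mult_mat[of _ n n _ n _ n])
  qed
  have cancel: "M k * (M' k * Y k * star (M' (k + r))) * star (M (k + r)) = Y k"
    if Y: "Y \<in> SF" and M: "\<And>k. M k \<in> carrier_mat n n" "\<And>k. M' k \<in> carrier_mat n n"
      and i: "\<And>k. M k * M' k = 1\<^sub>m n" for M M' Y k
  proof -
    have "star (M' (k + r)) * star (M (k + r)) = 1\<^sub>m n"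
      using star_mat_mult[of "M (k + r)" n "M' (k + r)" s] M i by simp
    hence "M k * (M' k * Y k * star (M' (k + r))) * star (M (k + r)) = (M k * M' k) * Y k"
      using Y M by (simp add: assoc_mult_mat[of _ n n _ n _ n] right_mult_one_mat[OF SF_carrier[OF Y]])
    thus ?thesis using Y i left_mult_one_mat[OF SF_carrier[OF Y]] by simp
  qed
  show ?thesis
  proof (rule bij_betwI[where g = "\<lambda>Y k. Z k * Y k * star (Z (k + r))"])
    show "(\<lambda>Y k. Zi k * Y k * star (Zi (k + r))) \<in> SF \<rightarrow> SF" using into[where M = Zi, OF _ Z(2) p(2)] by blast
    show "(\<lambda>Y k. Z k * Y k * star (Z (k + r))) \<in> SF \<rightarrow> SF" using into[where M = Z, OF _ Z(1) p(1)] by blast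
    show "(\<lambda>k. Z k * (Zi k * Y k * star (Zi (k + r))) * star (Z (k + r))) = Y" if "Y \<in> SF" for Y
      by (rule ext) (rule cancel[where M = Z and M' = Zi, OF that Z inv(2)])
    show "(\<lambda>k. Zi k * (Z k * Y k * star (Z (k + r))) * star (Zi (k + r))) = Y" if "Y \<in> SF" for Y
      by (rule ext) (rule cancel[where M = Zi and M' = Z, OF that Z(2,1) inv(1)])
  qed
qed

text \<open>Substituting \<open>Y\<^sub>k \<mapsto> Z\<^sub>k\<^sup>-\<^sup>1 Y\<^sub>k (Z\<^sub>k\<^sub>+\<^sub>r\<^sup>-\<^sup>1)\<^sup>\<star>\<close> cancels the factors \<open>Z\<close> on both sides of the unknowns and
leaves \<open>Q\<^sub>k\<close> on the left and \<open>Q\<^sub>k\<^sub>+\<^sub>r\<^sup>\<star>\<close> on the right, which can be moved to the right-hand sides.\<close>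
lemma equivalence_invariance:
  assumes Q: "\<And>k. Q k \<in> carrier_mat n n" "\<And>k. Qi k \<in> carrier_mat n n"
    and Qinv: "\<And>k. Qi k * Q k = 1\<^sub>m n" "\<And>k. Q k * Qi k = 1\<^sub>m n"
    and pQ: "\<And>k. Q (k + 2 * r) = Q k"  "\<And>k. Qi (k + 2 * r) = Qi k"
    and Z: "\<And>k. Z k \<in> carrier_mat n n" "\<And>k. Zi k \<in> carrier_mat n n"
    and Zinv: "\<And>k. Zi k * Z k = 1\<^sub>m n" "\<And>k. Z k * Zi k = 1\<^sub>m n"
    and pZ: "\<And>k. Z (k + 2 * r) = Z k"  "\<And>k. Zi (k + 2 * r) = Zi k"
  shows "doubled_nonsingular s n r (\<lambda>k. Q k * L k * Z k) (\<lambda>k. Q k * R k * Z (Suc k)) \<longleftrightarrow>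
    doubled_nonsingular s n r L R"
proof -
  let ?f = "\<lambda>Y k. Zi k * Y k * star (Zi (k + r))"
  let ?g = "\<lambda>E k. Q k * E k * star (Q (k + r))"
  let ?syl' = "sylvester_map s r (\<lambda>k. Q k * L k * Z k) (\<lambda>k. Q k * R k * Z (Suc k))"
  have bf: "bij_betw ?f SF SF" by (rule congruence_bij[where Z = Z and Zi = Zi, OF Z Zinv pZ])
  have bg: "bij_betw ?g SF SF" by (rule congruence_bij[where Z = Qi and Zi = Q, OF Q(2,1) Qinv(2,1) pQ(2,1)])
  have cancel: "(Q' * M * Z k) * (Zi k * Y * star (Zi l)) * star (Q'' * M' * Z l) =
      Q' * (M * Y * star M') * star Q''"
    if "Q' \<in> carrier_mat n n" "Q'' \<in> carrier_mat n n" "M \<in> carrier_mat n n" "M' \<in> carrier_mat n n" "Y \<in> carrier_mat n n"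
    for Q' Q'' M M' Y k l
  proof -
    have sl: "star (Zi l) * star (Z l) = 1\<^sub>m n" using star_mat_mult[of "Z l" n "Zi l" s] Z Zinv by simp
    have "(Q' * M * Z k) * (Zi k * Y * star (Zi l)) * star (Q'' * M' * Z l) =
        Q' * M * (Z k * Zi k) * Y * (star (Zi l) * star (Z l)) * star M' * star Q''"
      using that Z by (simp add: star_mat_mult[of _ n] assoc_mult_mat[of _ n n _ n _ n])
    also have "\<dots> = Q' * (M * Y * star M') * star Q''"
      unfolding sl Zinv using that by (simp add: assoc_mult_mat[of _ n n _ n _ n] left_mult_one_mat[of _ n n])
    finally show ?thesis .
  qed
  have "?syl' (?f Y) k = ?g (syl Y) k" if Y: "Y \<in> SF" for Y k
  proof -
    have c: "L k * Y k * star (L (k + r)) \<in> carrier_mat n n" "R k * Y (Suc k) * star (R (k + r)) \<in> carrier_mat n n"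
      using Y by simp_all
    have "?syl' (?f Y) k = Q k * (L k * Y k * star (L (k + r))) * star (Q (k + r)) -
        Q k * (R k * Y (Suc k) * star (R (k + r))) * star (Q (k + r))"
      unfolding sylvester_map_def
      by (simp only: cancel[OF Q(1) Q(1) L L SF_carrier[OF Y]] cancel[OF Q(1) Q(1) R R SF_carrier[OF Y]] add_Suc)
    also have "\<dots> = Q k * syl Y k * star (Q (k + r))"
      unfolding sylvester_map_def mult_minus_distrib_mat[OF Q(1) c]
        minus_mult_distrib_mat[OF square_carrier[OF Q(1) c(1)] square_carrier[OF Q(1) c(2)] star_mat_carrier[OF Q(1)]] ..
    finally show ?thesis .
  qed
  hence syl': "?syl' (?f Y) = ?g (syl Y)" if "Y \<in> SF" for Y
    using that by (intro ext) blast
  have eq: "(\<forall>k. ?syl' (?f Y) k = ?g E k) \<longleftrightarrow> (\<forall>k. syl Y k = E k)" if Y: "Y \<in> SF" and E: "E \<in> SF" for Y E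
  proof -
    have "(\<forall>k. ?syl' (?f Y) k = ?g E k) \<longleftrightarrow> ?g (syl Y) = ?g E"
      unfolding syl'[OF Y] by (simp only: fun_eq_iff)
    also have "\<dots> \<longleftrightarrow> syl Y = E"
      using bij_betw_imp_inj_on[OF bg] syl_in_SF[OF Y] E by (rule inj_on_eq_iff)
    finally show ?thesis by (simp only: fun_eq_iff)
  qed
  show ?thesis unfolding doubled_nonsingular_def
  proof (rule unique_solvability_transfer[OF bf])
    fix E assume E: "E \<in> SF"
    show "\<exists>E'\<in>SF. \<forall>Y\<in>SF. (\<forall>k. ?syl' (?f Y) k = E' k) \<longleftrightarrow> (\<forall>k. syl Y k = E k)"
    proof (rule bexI[of _ "?g E"], rule ballI)
      show "(\<forall>k. ?syl' (?f Y) k = ?g E k) \<longleftrightarrow> (\<forall>k. syl Y k = E k)" if "Y \<in> SF" for Y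
        by (rule eq[OF that E])
      show "?g E \<in> SF" using bij_betwE[OF bg] E by (rule bspec)
    qed
  next
    fix E' assume "E' \<in> SF"
    hence "E' \<in> ?g ` SF" unfolding bij_betw_imp_surj_on[OF bg] .
    then obtain E where E': "E' = ?g E" and E: "E \<in> SF" by (rule imageE)
    show "\<exists>E\<in>SF. \<forall>Y\<in>SF. (\<forall>k. ?syl' (?f Y) k = E' k) \<longleftrightarrow> (\<forall>k. syl Y k = E k)"
      unfolding E'
    proof (rule bexI[OF _ E], rule ballI)
      show "(\<forall>k. ?syl' (?f Y) k = ?g E k) \<longleftrightarrow> (\<forall>k. syl Y k = E k)" if "Y \<in> SF" for Y
        by (rule eq[OF that E])
    qed
  qed
qed

end

text \<open>One construction serves for both coefficient families: applied to \<open>A\<close>, \<open>B\<close> it gives the left family,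
applied to \<open>C\<close>, \<open>D\<close> the right one. Here the index starts at \<open>0\<close>, whereas \<open>A\<close> and \<open>B\<close> are indexed from \<open>1\<close>.\<close>
definition doubled_family :: "star_kind \<Rightarrow> nat \<Rightarrow> (nat \<Rightarrow> complex mat) \<Rightarrow> (nat \<Rightarrow> complex mat) \<Rightarrow> nat \<Rightarrow> complex mat" where
  "doubled_family s r A B k =
     (if k mod (2 * r) < r then A (Suc (k mod (2 * r))) else star_mat s (B (Suc (k mod (2 * r) - r))))"

lemma doubled_family_simps:
  assumes "t < r"
  shows "doubled_family s r A B t = A (Suc t)" "doubled_family s r A B (t + r) = star_mat s (B (Suc t))"
proof -
  have "t mod (2 * r) = t" "(t + r) mod (2 * r) = t + r" using assms by (intro mod_less; simp)+
  thus "doubled_family s r A B t = A (Suc t)" "doubled_family s r A B (t + r) = star_mat s (B (Suc t))"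
    using assms unfolding doubled_family_def by simp_all
qed

lemma doubled_family_periodic: "doubled_family s r A B (k + 2 * r) = doubled_family s r A B k"
  unfolding doubled_family_def mod_add_self2 ..

lemma doubled_family_carrier:
  assumes r: "r \<ge> 1" and "\<And>k. k \<in> {1..r} \<Longrightarrow> A k \<in> carrier_mat n n" "\<And>k. k \<in> {1..r} \<Longrightarrow> B k \<in> carrier_mat n n"
  shows "doubled_family s r A B k \<in> carrier_mat n n"
proof -
  define t where "t = k mod (2 * r)"
  have "t < 2 * r" using r unfolding t_def by simp
  show ?thesis
  proof (cases "t < r")
    case True
    hence "A (Suc t) \<in> carrier_mat n n" by (intro assms(2)) simp
    thus ?thesis using True unfolding doubled_family_def t_def[symmetric] by simp
  next
    case False
    hence "B (Suc (t - r)) \<in> carrier_mat n n" using \<open>t < 2 * r\<close> by (intro assms(3)) auto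
    thus ?thesis using False unfolding doubled_family_def t_def[symmetric] by simp
  qed
qed

lemma cyclic_pair_doubled:
  assumes "r \<ge> 1"
    and "\<And>k. k \<in> {1..r} \<Longrightarrow> A k \<in> carrier_mat n n" "\<And>k. k \<in> {1..r} \<Longrightarrow> B k \<in> carrier_mat n n"
    and "\<And>k. k \<in> {1..r} \<Longrightarrow> C k \<in> carrier_mat n n" "\<And>k. k \<in> {1..r} \<Longrightarrow> D k \<in> carrier_mat n n"
  shows "cyclic_pair n r (doubled_family s r A B) (doubled_family s r C D)"
proof unfold_locales
  show "1 \<le> r" by (rule assms)
  show "doubled_family s r A B k \<in> carrier_mat n n" for k by (rule doubled_family_carrier[OF assms(1-3)])
  show "doubled_family s r C D k \<in> carrier_mat n n" for k by (rule doubled_family_carrier[OF assms(1,4,5)])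
qed (rule doubled_family_periodic)+

text \<open>The first \<open>r\<close> equations of the doubled system are the original ones, the other ones are their stars and
hold automatically, and \<open>Y\<^sub>r = Y\<^sub>0\<^sup>\<star>\<close> accounts for the exceptional last equation.\<close>
lemma nonsingular_system_iff_doubled:
  assumes r: "r \<ge> 1"
    and A: "\<And>k. k \<in> {1..r} \<Longrightarrow> A k \<in> carrier_mat n n" and B: "\<And>k. k \<in> {1..r} \<Longrightarrow> B k \<in> carrier_mat n n"
    and C: "\<And>k. k \<in> {1..r} \<Longrightarrow> C k \<in> carrier_mat n n" and D: "\<And>k. k \<in> {1..r} \<Longrightarrow> D k \<in> carrier_mat n n"
  shows "nonsingular_system s n r A B C D \<longleftrightarrow>
    doubled_nonsingular s n r (doubled_family s r A B) (doubled_family s r C D)"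
proof -
  interpret cyclic_pair s n r "doubled_family s r A B" "doubled_family s r C D"
    by (rule cyclic_pair_doubled[OF assms])
  let ?f = "\<lambda>Y. restrict (\<lambda>k. Y (k - 1)) {1..r}"
  let ?ext = "\<lambda>X. twisted_extension r star (\<lambda>t. X (Suc t))"
  have extSF: "?ext X \<in> SF" if "X \<in> {1..r} \<rightarrow> carrier_mat n n" for X
  proof -
    have iter: "(star ^^ m) M \<in> carrier_mat n n" if "M \<in> carrier_mat n n" for m M
      using that by (induction m) simp_all
    have "?ext X k \<in> carrier_mat n n" for k
    proof -
      have "k mod r < r" using r by simp
      hence "X (Suc (k mod r)) \<in> carrier_mat n n" using that by (intro Pi_mem[of X]) auto
      thus ?thesis unfolding twisted_extension_def by (rule iter)
    qed
    thus ?thesis using twisted_periodic_extension[OF r] unfolding star_families_def by blast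
  qed
  have bf: "bij_betw ?f SF ({1..r} \<rightarrow>\<^sub>E carrier_mat n n)"
  proof (rule bij_betwI[where g = ?ext])
    show "?f \<in> SF \<rightarrow> {1..r} \<rightarrow>\<^sub>E carrier_mat n n" by auto
    show "?ext \<in> ({1..r} \<rightarrow>\<^sub>E carrier_mat n n) \<rightarrow> SF" using extSF by (auto simp: PiE_def)
    show "?ext (?f Y) = Y" if Y: "Y \<in> SF" for Y
    proof
      fix k
      have "k mod r < r" using r by simp
      hence "?ext (?f Y) k = (star ^^ (k div r)) (Y (k mod r))" unfolding twisted_extension_def by simp
      also have "\<dots> = Y k"
        using twisted_periodic_window[of r star Y k] Y unfolding star_families_def by simp
      finally show "?ext (?f Y) k = Y k" .
    qed
    show "?f (?ext X) = X" if X: "X \<in> {1..r} \<rightarrow>\<^sub>E carrier_mat n n" for X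
    proof
      fix k show "?f (?ext X) k = X k"
      proof (cases "k \<in> {1..r}")
        case True
        hence "k - 1 < r" "Suc (k - 1) = k" by auto
        thus ?thesis using True by simp
      next
        case False
        thus ?thesis using X by (auto simp: PiE_def extensional_def)
      qed
    qed
  qed
  have rel: "solves_system s r A B C D E (?f Y) \<longleftrightarrow> (\<forall>k. syl Y k = E' k)"
    if Y: "Y \<in> SF" and E': "E' \<in> SF" and EE: "\<And>t. t < r \<Longrightarrow> E' t = E (Suc t)"
    for Y E' and E :: "nat \<Rightarrow> complex mat"
  proof -
    have tp: "twisted_periodic r star (syl Y)" "twisted_periodic r star E'"
      using syl_in_SF[OF Y] E' unfolding star_families_def by auto
    have syl: "syl Y t = A (Suc t) * Y t * B (Suc t) - C (Suc t) * Y (Suc t) * D (Suc t)" if "t < r" for t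
      using that B[of "Suc t"] D[of "Suc t"] unfolding sylvester_map_def by (simp add: doubled_family_simps)
    have Yr: "Y r = star (Y 0)" using SF_shift[OF Y, of 0] by simp
    have "(\<forall>k. syl Y k = E' k) \<longleftrightarrow> (\<forall>t<r. syl Y t = E (Suc t))"
      using twisted_periodic_eqI[OF tp r] EE by metis
    also have "\<dots> \<longleftrightarrow> (\<forall>k\<in>{1..r}. syl Y (k - 1) = E k)"
    proof -
      have "{1..r} = Suc ` {..<r}" by (simp add: image_Suc_lessThan)
      thus ?thesis by auto
    qed
    also have "\<dots> \<longleftrightarrow> (\<forall>k\<in>{1..<r}. syl Y (k - 1) = E k) \<and> syl Y (r - 1) = E r"
    proof -
      have "{1..r} = insert r {1..<r}" using r by auto
      thus ?thesis by auto
    qed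
    also have "\<dots> \<longleftrightarrow> solves_system s r A B C D E (?f Y)"
    proof -
      have e1: "syl Y (k - 1) = A k * ?f Y k * B k - C k * ?f Y (k + 1) * D k" if "k \<in> {1..<r}" for k
      proof -
        have "k - 1 < r" "Suc (k - 1) = k" using that by auto
        thus ?thesis using syl[of "k - 1"] that by simp
      qed
      have e2: "syl Y (r - 1) = A r * ?f Y r * B r - C r * star (?f Y 1) * D r"
        using syl[of "r - 1"] r Yr by simp
      show ?thesis unfolding solves_system_def by (simp only: e1 e2 cong: ball_cong)
    qed
    finally show ?thesis by (rule sym)
  qed
  show ?thesis unfolding nonsingular_system_def doubled_nonsingular_def
  proof (rule unique_solvability_transfer[OF bf])
    fix E' assume E': "E' \<in> SF"
    show "\<exists>E\<in>{1..r} \<rightarrow> carrier_mat n n. \<forall>Y\<in>SF. solves_system s r A B C D E (?f Y) \<longleftrightarrow> (\<forall>k. syl Y k = E' k)"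
    proof (rule bexI[of _ "\<lambda>k. E' (k - 1)"], rule ballI)
      show "solves_system s r A B C D (\<lambda>k. E' (k - 1)) (?f Y) \<longleftrightarrow> (\<forall>k. syl Y k = E' k)" if "Y \<in> SF" for Y
        by (rule rel[OF that E']) simp
    qed (use E' in simp)
  next
    fix E :: "nat \<Rightarrow> complex mat" assume E: "E \<in> {1..r} \<rightarrow> carrier_mat n n"
    show "\<exists>E'\<in>SF. \<forall>Y\<in>SF. solves_system s r A B C D E (?f Y) \<longleftrightarrow> (\<forall>k. syl Y k = E' k)"
    proof (rule bexI[OF _ extSF[OF E]], rule ballI)
      show "solves_system s r A B C D E (?f Y) \<longleftrightarrow> (\<forall>k. syl Y k = ?ext E k)" if "Y \<in> SF" for Y
        by (rule rel[OF that extSF[OF E]]) simp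
    qed
  qed
qed


section \<open>Periodic families and closed walks\<close>
abbreviation periodic :: "nat \<Rightarrow> (nat \<Rightarrow> 'a) \<Rightarrow> bool" where
  "periodic N f \<equiv> twisted_periodic N (\<lambda>x. x) f"

lemma periodicD: "periodic N f \<Longrightarrow> f (k + N) = f k"
  unfolding twisted_periodic_def by blast

lemma periodic_Suc: "periodic N f \<Longrightarrow> periodic N (\<lambda>k. f (Suc k))"
  unfolding twisted_periodic_def by (metis add_Suc)

lemma periodic_mod: "periodic N f \<Longrightarrow> f (k mod N) = f k"
proof -
  assume p: "periodic N f"
  have "((\<lambda>x. x) ^^ t) x = x" for t and x :: 'a by (induction t) auto
  thus ?thesis using twisted_periodic_window[OF p, of k] by simp
qed

lemma periodic_cong_mod: "periodic N f \<Longrightarrow> k mod N = l mod N \<Longrightarrow> f k = f l"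
  by (metis periodic_mod)

text \<open>Choosing by \<open>SOME\<close> makes equal sets of candidates yield equal choices, hence periodic ones.\<close>
lemma periodic_choice:
  assumes "periodic N P" "\<And>k. \<exists>x. P k x"
  shows "\<exists>f. periodic N f \<and> (\<forall>k. P k (f k))"
proof -
  have "\<forall>k. P k (SOME x. P k x)" using assms(2) by (metis someI_ex)
  moreover have "periodic N (\<lambda>k. SOME x. P k x)" using assms(1) unfolding twisted_periodic_def by simp
  ultimately show ?thesis by blast
qed

text \<open>The window may start at any index \<open>c\<close>, which lets a closed walk be built from whichever index is
convenient.\<close>
lemma closed_walk_from_window:
  assumes N: "N \<ge> 1" and P: "periodic N P"
    and u: "\<And>t. t < N \<Longrightarrow> P (c + t) (u t) (u (Suc t mod N))"
  shows "\<exists>v. periodic N v \<and> (\<forall>k. P k (v k) (v (Suc k)))"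
proof -
  \<comment> \<open>Shifting by \<open>d\<close> moves the start of the window to a multiple of the period.\<close>
  define d where "d = c * N - c"
  have cd: "c + d = c * N" using N unfolding d_def by (cases N) auto
  define v where "v = (\<lambda>k. u ((k + d) mod N))"
  have "P k (v k) (v (Suc k))" for k
  proof -
    have "(c + (k + d) mod N) mod N = (k + (c + d)) mod N"
      by (metis add.commute add.left_commute mod_add_right_eq)
    hence "(c + (k + d) mod N) mod N = k mod N" unfolding cd by simp
    hence "P (c + (k + d) mod N) = P k" by (rule periodic_cong_mod[OF P])
    moreover have "u (Suc ((k + d) mod N) mod N) = v (Suc k)"
      unfolding v_def by (simp add: mod_Suc_eq)
    ultimately show ?thesis using u[of "(k + d) mod N"] N unfolding v_def by simp
  qed
  moreover have "periodic N v" unfolding twisted_periodic_def v_def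
    by (metis add.assoc add.commute mod_add_self2)
  ultimately show ?thesis by blast
qed

text \<open>If some relation \<open>P\<^sub>c\<close> relates everything to \<open>y\<^sub>0\<close>, then a walk started at \<open>y\<^sub>0\<close> just after \<open>c\<close> can proceed
arbitrarily and still closes up when it comes back to \<open>c\<close>.\<close>
lemma closed_walk_forward:
  assumes N: "N \<ge> 1" and P: "periodic N P" and step: "\<And>k x. x \<in> S \<Longrightarrow> \<exists>y. y \<in> S \<and> P k x y"
    and y0: "y0 \<in> S" "\<And>x. x \<in> S \<Longrightarrow> P c x y0"
  shows "\<exists>v. periodic N v \<and> (\<forall>k. v k \<in> S \<and> P k (v k) (v (Suc k)))"
proof -
  define P' where "P' = (\<lambda>k x y. x \<in> S \<and> y \<in> S \<and> P k x y)"
  have P': "periodic N P'" using P unfolding P'_def twisted_periodic_def by simp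
  have "\<exists>u. \<forall>t. (u t \<in> S \<and> (t = 0 \<longrightarrow> u t = y0)) \<and> P (Suc c + t) (u t) (u (Suc t))"
    by (rule dependent_nat_choice) (use y0 step in auto)
  then obtain u where u: "\<And>t. u t \<in> S" "u 0 = y0" "\<And>t. P (Suc c + t) (u t) (u (Suc t))" by blast
  have "P' (Suc c + t) (u t) (u (Suc t mod N))" if "t < N" for t
  proof (cases "Suc t = N")
    case True
    hence "P (Suc c + t) = P c" using periodicD[OF P, of c] by (metis add_Suc add_Suc_right)
    thus ?thesis using True u y0 unfolding P'_def by simp
  next
    case False
    thus ?thesis using that u unfolding P'_def by simp
  qed
  from closed_walk_from_window[OF N P' this] show ?thesis unfolding P'_def by blast
qed

text \<open>The mirror image of \<open>closed_walk_forward\<close>: the walk is built backwards, from \<open>x\<^sub>0\<close> at index \<open>c + N\<close> down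
to index \<open>c + 1\<close>.\<close>
lemma closed_walk_backward:
  assumes N: "N \<ge> 1" and P: "periodic N P" and step: "\<And>k y. y \<in> S \<Longrightarrow> \<exists>x. x \<in> S \<and> P k x y"
    and x0: "x0 \<in> S" "\<And>y. y \<in> S \<Longrightarrow> P c x0 y"
  shows "\<exists>v. periodic N v \<and> (\<forall>k. v k \<in> S \<and> P k (v k) (v (Suc k)))"
proof -
  define P' where "P' = (\<lambda>k x y. x \<in> S \<and> y \<in> S \<and> P k x y)"
  have P': "periodic N P'" using P unfolding P'_def twisted_periodic_def by simp
  have "\<exists>w. \<forall>t. (w t \<in> S \<and> (t = 0 \<longrightarrow> w t = x0)) \<and> P (c + N - Suc t) (w (Suc t)) (w t)"
    by (rule dependent_nat_choice) (use x0 step in auto)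
  then obtain w where w: "\<And>t. w t \<in> S" "w 0 = x0" "\<And>t. P (c + N - Suc t) (w (Suc t)) (w t)" by blast
  define u where "u = (\<lambda>t. w ((N - t) mod N))"
  have uS: "u t \<in> S" for t unfolding u_def by (rule w)
  have "P' (c + t) (u t) (u (Suc t mod N))" if t: "t < N" for t
  proof (cases "t = 0")
    case True
    thus ?thesis using uS x0 w(2) unfolding P'_def by (simp add: u_def)
  next
    case False
    define t' where "t' = N - Suc t"
    have t': "c + N - Suc t' = c + t" "Suc t' = N - t" using t unfolding t'_def by auto
    have "u t = w (Suc t')" unfolding u_def t'(2) using False t by simp
    moreover have "u (Suc t mod N) = w t'"
    proof (cases "Suc t = N")
      case True
      thus ?thesis unfolding u_def t'_def by simp
    next
      case False
      thus ?thesis using t unfolding u_def t'_def by simp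
    qed
    ultimately show ?thesis using uS w(3)[of t'] unfolding P'_def t'(1) by metis
  qed
  from closed_walk_from_window[OF N P' this] show ?thesis unfolding P'_def by blast
qed

section \<open>Vectors aligned by two periodic families of matrices\<close>

lemma det_nonzero_inverse:
  assumes M: "M \<in> carrier_mat n n" and d: "det M \<noteq> (0 :: complex)"
  obtains M' where "M' \<in> carrier_mat n n" "M' * M = 1\<^sub>m n" "M * M' = 1\<^sub>m n" "det M' \<noteq> 0"
proof -
  from det_non_zero_imp_unit[OF M d, of "()"] obtain M' where
    m: "M' \<in> carrier_mat n n" "M' * M = 1\<^sub>m n" "M * M' = 1\<^sub>m n"
    unfolding Units_def by (auto simp: ring_mat_simps)
  have "det M' * det M = 1" using det_mult[OF m(1) M] m(2) by simp
  hence "det M' \<noteq> 0" by auto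
  thus ?thesis using that m by blast
qed

lemma mult_mat_vec_nonzero:
  assumes "M \<in> carrier_mat n n" "det M \<noteq> (0 :: complex)" "v \<in> carrier_vec n" "v \<noteq> 0\<^sub>v n"
  shows "M *\<^sub>v v \<noteq> 0\<^sub>v n"
  using det_0_iff_vec_prod_zero_field[OF assms(1)] assms by blast

lemma mult_mat_unit_vec:
  fixes M :: "complex mat"
  assumes "M \<in> carrier_mat m n" "j < n"
  shows "M *\<^sub>v unit_vec n j = col M j"
  using assms by (intro eq_vecI) auto

text \<open>Complete the vector to a basis and orthogonalize: this keeps the first vector, and a matrix with orthogonal
nonzero columns has an explicit inverse.\<close>
lemma matrix_with_first_column:
  fixes v :: "complex vec"
  assumes v: "v \<in> carrier_vec n" and v0: "v \<noteq> 0\<^sub>v n"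
  shows "\<exists>W \<in> carrier_mat n n. det W \<noteq> 0 \<and> W *\<^sub>v unit_vec n 0 = v"
proof -
  interpret cof_vec_space n "TYPE(complex)" .
  have n: "n > 0" using v v0 by (cases n) auto
  define b where "b = basis_completion v"
  define ws where "ws = gram_schmidt n b"
  define W where "W = mat_of_cols n ws"
  note b = basis_completion[OF v v0, folded b_def]
  obtain vs where bv: "b = v # vs" using b(6,7) n by (cases b) auto
  have ws: "set ws \<subseteq> carrier_vec n" "corthogonal ws" "length ws = n"
    using gram_schmidt_result[OF b(2,4,5) refl, folded ws_def] b(6) by auto
  have hdws: "hd ws = v" using gram_schmidt_hd[OF v, of vs, folded bv] unfolding ws_def .
  have W: "W \<in> carrier_mat n n" using ws unfolding W_def by (auto simp: mat_of_cols_carrier)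
  have "corthogonal_mat W" using orthogonal_mat_of_cols ws unfolding W_def by blast
  hence inv: "corthogonal_inv W * W = 1\<^sub>m n"
    using corthogonal_inv_result[of W] W unfolding inverts_mat_def corthogonal_inv_def by auto
  have "corthogonal_inv W \<in> carrier_mat n n" unfolding corthogonal_inv_def using W
    by (auto simp: mat_of_rows_def)
  hence "det (corthogonal_inv W) * det W = 1" using det_mult[OF _ W] inv by (metis det_one)
  hence "det W \<noteq> 0" by auto
  moreover have "W *\<^sub>v unit_vec n 0 = v"
    unfolding mult_mat_unit_vec[OF W n] using ws n hdws unfolding W_def
    by (cases ws) (auto simp: col_mat_of_cols)
  ultimately show ?thesis using W by blast
qed

text \<open>Both images lie on the line spanned by \<open>w\<close>, which is allowed to be any line through an image that is zero.
Choosing \<open>x\<close>, \<open>y\<close>, \<open>w\<close> as first basis vectors makes the first columns of \<open>L\<close> and \<open>R\<close> multiples of the first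
unit vector.\<close>
definition aligned :: "nat \<Rightarrow> complex mat \<Rightarrow> complex mat \<Rightarrow> complex vec \<Rightarrow> complex vec \<Rightarrow> complex vec \<Rightarrow> bool" where
  "aligned n L R x y w \<longleftrightarrow> w \<in> carrier_vec n \<and> w \<noteq> 0\<^sub>v n \<and>
     (\<exists>a. L *\<^sub>v x = a \<cdot>\<^sub>v w) \<and> (\<exists>b. R *\<^sub>v y = b \<cdot>\<^sub>v w)"

lemma vec_in_some_line:
  fixes y :: "complex vec"
  assumes "y \<in> carrier_vec n" "n > 0"
  shows "\<exists>w\<in>carrier_vec n. w \<noteq> 0\<^sub>v n \<and> (\<exists>c. y = c \<cdot>\<^sub>v w)"
proof (cases "y = 0\<^sub>v n")
  case True
  hence "y = 0 \<cdot>\<^sub>v unit_vec n 0" by (auto intro!: eq_vecI)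
  thus ?thesis using assms(2) unit_vec_nonzero unit_vec_carrier by blast
next
  case False
  have "y = 1 \<cdot>\<^sub>v y" by simp
  thus ?thesis using False assms by blast
qed

text \<open>If \<open>M\<close> is singular, take \<open>x\<close> in its kernel. If \<open>M\<close> is invertible, take \<open>x = M\<^sup>-\<^sup>1 y\<close>, unless \<open>y = 0\<close>, when
every \<open>x\<close> will do. So alignment can be continued from either of the two vectors to the other.\<close>
lemma vec_mapped_into_line:
  fixes M :: "complex mat"
  assumes M: "M \<in> carrier_mat n n" and y: "y \<in> carrier_vec n" and n: "n > 0"
  shows "\<exists>x\<in>carrier_vec n. x \<noteq> 0\<^sub>v n \<and>
    (\<exists>w\<in>carrier_vec n. w \<noteq> 0\<^sub>v n \<and> (\<exists>a. M *\<^sub>v x = a \<cdot>\<^sub>v w) \<and> (\<exists>b. y = b \<cdot>\<^sub>v w))"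
proof (cases "det M = 0")
  case True
  then obtain x where x: "x \<in> carrier_vec n" "x \<noteq> 0\<^sub>v n" "M *\<^sub>v x = 0\<^sub>v n"
    using det_0_iff_vec_prod_zero_field[OF M] by blast
  obtain w b where w: "w \<in> carrier_vec n" "w \<noteq> 0\<^sub>v n" "y = b \<cdot>\<^sub>v w" using vec_in_some_line[OF y n] by blast
  have "M *\<^sub>v x = 0 \<cdot>\<^sub>v w" using x w by (auto intro!: eq_vecI)
  thus ?thesis using x w by blast
next
  case False
  show ?thesis
  proof (cases "y = 0\<^sub>v n")
    case True
    define x :: "complex vec" where "x = unit_vec n 0"
    have x: "x \<in> carrier_vec n" "x \<noteq> 0\<^sub>v n" unfolding x_def using n by auto
    have "y = 0 \<cdot>\<^sub>v (M *\<^sub>v x)" "M *\<^sub>v x = 1 \<cdot>\<^sub>v (M *\<^sub>v x)" using True x M by (auto intro!: eq_vecI)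
    thus ?thesis using x mult_mat_vec_nonzero[OF M False x] mult_mat_vec_carrier[OF M x(1)] by blast
  next
    case y0: False
    obtain M' where M': "M' \<in> carrier_mat n n" "M' * M = 1\<^sub>m n" "M * M' = 1\<^sub>m n" "det M' \<noteq> 0"
      using det_nonzero_inverse[OF M False] by blast
    have "M *\<^sub>v (M' *\<^sub>v y) = (M * M') *\<^sub>v y" by (rule assoc_mult_mat_vec[OF M M'(1) y, symmetric])
    hence "M *\<^sub>v (M' *\<^sub>v y) = 1 \<cdot>\<^sub>v y" using M' y by simp
    moreover have "y = 1 \<cdot>\<^sub>v y" by simp
    ultimately show ?thesis using mult_mat_vec_nonzero[OF M'(1,4) y y0] mult_mat_vec_carrier[OF M'(1) y] y y0
      by blast
  qed
qed

text \<open>The first step of the periodic Schur form. If some \<open>R\<^sub>c\<close> is singular, a kernel vector of \<open>R\<^sub>c\<close> is aligned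
with every vector, and a walk along aligned vectors that is started there closes up; likewise if some \<open>L\<^sub>c\<close> is
singular, with a backward walk. If all matrices are invertible, the walk
\<open>v\<^sub>k\<^sub>+\<^sub>1 = R\<^sub>k\<^sup>-\<^sup>1 L\<^sub>k v\<^sub>k\<close> never reaches \<open>0\<close>, and it closes up to a scalar factor if it starts at an
eigenvector of the product of the matrices \<open>R\<^sub>k\<^sup>-\<^sup>1 L\<^sub>k\<close> over one period.\<close>
lemma periodic_aligned_vectors:
  assumes N: "N \<ge> 1" and n: "n > 0" and pL: "periodic N L" and pR: "periodic N R"
    and L: "\<And>k. L k \<in> carrier_mat n n" and R: "\<And>k. R k \<in> carrier_mat n n"
  shows "\<exists>v w. periodic N v \<and> periodic N w \<and>
    (\<forall>k. v k \<in> carrier_vec n \<and> v k \<noteq> 0\<^sub>v n \<and> aligned n (L k) (R k) (v k) (v (Suc k)) (w k))"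
proof -
  define S :: "complex vec set" where "S = {v \<in> carrier_vec n. v \<noteq> 0\<^sub>v n}"
  define P where "P = (\<lambda>k x y. \<exists>w. aligned n (L k) (R k) x y w)"
  have P: "periodic N P" using pL pR unfolding P_def twisted_periodic_def by simp
  have fwd: "\<exists>y. y \<in> S \<and> P k x y" if "x \<in> S" for k x
    using vec_mapped_into_line[OF R[of k] mult_mat_vec_carrier[OF L[of k]] n, of x] that
    unfolding S_def P_def aligned_def by blast
  have bwd: "\<exists>x. x \<in> S \<and> P k x y" if "y \<in> S" for k y
    using vec_mapped_into_line[OF L[of k] mult_mat_vec_carrier[OF R[of k]] n, of y] that
    unfolding S_def P_def aligned_def by blast
  have "\<exists>v. periodic N v \<and> (\<forall>k. v k \<in> S \<and> P k (v k) (v (Suc k)))"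
  proof -
    consider c where "det (R c) = 0" | c where "det (L c) = 0"
      | "\<And>k. det (L k) \<noteq> 0" "\<And>k. det (R k) \<noteq> 0" by blast
    thus ?thesis
    proof cases
      case 1
      then obtain y where y: "y \<in> S" "R c *\<^sub>v y = 0\<^sub>v n"
        using det_0_iff_vec_prod_zero_field[OF R[of c]] unfolding S_def by blast
      have "P c x y" if "x \<in> S" for x
      proof -
        have "L c *\<^sub>v x \<in> carrier_vec n" using that L[of c] unfolding S_def by auto
        from vec_in_some_line[OF this n] obtain w where
          w: "w\<in>carrier_vec n" "w \<noteq> 0\<^sub>v n" "\<exists>a. L c *\<^sub>v x = a \<cdot>\<^sub>v w" by blast
        have "R c *\<^sub>v y = 0 \<cdot>\<^sub>v w" using y w by (auto intro!: eq_vecI)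
        thus ?thesis using w unfolding P_def aligned_def by blast
      qed
      from closed_walk_forward[OF N P fwd y(1) this] show ?thesis by blast
    next
      case 2
      then obtain x where x: "x \<in> S" "L c *\<^sub>v x = 0\<^sub>v n"
        using det_0_iff_vec_prod_zero_field[OF L[of c]] unfolding S_def by blast
      have "P c x y" if "y \<in> S" for y
      proof -
        have "R c *\<^sub>v y \<in> carrier_vec n" using that R[of c] unfolding S_def by auto
        from vec_in_some_line[OF this n] obtain w where
          w: "w\<in>carrier_vec n" "w \<noteq> 0\<^sub>v n" "\<exists>a. R c *\<^sub>v y = a \<cdot>\<^sub>v w" by blast
        have "L c *\<^sub>v x = 0 \<cdot>\<^sub>v w" using x w by (auto intro!: eq_vecI)
        thus ?thesis using w unfolding P_def aligned_def by blast
      qed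
      from closed_walk_backward[OF N P bwd x(1) this] show ?thesis by blast
    next
      case 3
      have "\<exists>G\<in>carrier_mat n n. R k * G = L k \<and> det G \<noteq> 0" for k
      proof -
        obtain R' where R': "R' \<in> carrier_mat n n" "R k * R' = 1\<^sub>m n" "det R' \<noteq> 0"
          using det_nonzero_inverse[OF R 3(2)] by blast
        have "R k * (R' * L k) = L k" using assoc_mult_mat[OF R R'(1) L, of k k] R' left_mult_one_mat[OF L, of k] by simp
        moreover have "det (R' * L k) \<noteq> 0" using det_mult[OF R'(1) L] R' 3 by simp
        ultimately show ?thesis using mult_carrier_mat[OF R'(1) L, of k] by blast
      qed
      then obtain G where G: "\<And>k. G k \<in> carrier_mat n n" "\<And>k. R k * G k = L k" "\<And>k. det (G k) \<noteq> 0"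
        by metis
      define M where "M = rec_nat (1\<^sub>m n) (\<lambda>k X. G k * X)"
      have M0: "M 0 = 1\<^sub>m n" and MS: "\<And>k. M (Suc k) = G k * M k" unfolding M_def by auto
      have M: "M k \<in> carrier_mat n n \<and> det (M k) \<noteq> 0" for k
        by (induction k) (auto simp: M0 MS intro!: G mult_carrier_mat[of _ n n] simp: det_mult[OF G(1)] G)
      obtain \<mu> x where "eigenvector (M N) x \<mu>"
        using spectrum_non_empty[of "M N" n] M n unfolding spectrum_def eigenvalue_def by blast
      hence x: "x \<in> carrier_vec n" "x \<noteq> 0\<^sub>v n" "M N *\<^sub>v x = \<mu> \<cdot>\<^sub>v x"
        using M[of N] unfolding eigenvector_def by auto
      define u where "u = (\<lambda>t. M t *\<^sub>v x)"
      have u: "u t \<in> carrier_vec n" "u t \<noteq> 0\<^sub>v n" for t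
        unfolding u_def using M[of t] x mult_mat_vec_nonzero[of "M t" n x] mult_mat_vec_carrier[of "M t" n n x] by blast+
      have step: "L t *\<^sub>v u t = R t *\<^sub>v u (Suc t)" for t
      proof -
        have "R t *\<^sub>v u (Suc t) = R t *\<^sub>v (G t *\<^sub>v u t)"
          unfolding u_def MS using assoc_mult_mat_vec[OF G(1) _ x(1)] M by simp
        thus ?thesis using assoc_mult_mat_vec[OF R G(1) u(1), of t t] G(2) by simp
      qed
      define P' where "P' = (\<lambda>k x y. x \<in> S \<and> y \<in> S \<and> P k x y)"
      have P': "periodic N P'" using P unfolding P'_def twisted_periodic_def by simp
      have "P' (0 + t) (u t) (u (Suc t mod N))" if t: "t < N" for t
      proof -
        define y where "y = u (Suc t mod N)"
        have y: "y \<in> carrier_vec n" "y \<noteq> 0\<^sub>v n" unfolding y_def by (rule u)+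
        have "\<exists>a. u (Suc t) = a \<cdot>\<^sub>v y"
        proof (cases "Suc t = N")
          case True
          thus ?thesis using x M0 unfolding y_def u_def by auto
        next
          case False
          hence "u (Suc t) = 1 \<cdot>\<^sub>v y" using t unfolding y_def by simp
          thus ?thesis by blast
        qed
        then obtain a where "u (Suc t) = a \<cdot>\<^sub>v y" by blast
        hence "L t *\<^sub>v u t = a \<cdot>\<^sub>v (R t *\<^sub>v y)" using step mult_mat_vec[OF R y(1)] by simp
        moreover have "R t *\<^sub>v y = 1 \<cdot>\<^sub>v (R t *\<^sub>v y)" by simp
        ultimately show ?thesis
          using u[of t] y mult_mat_vec_nonzero[OF R 3(2) y] mult_mat_vec_carrier[OF R y(1)]
          unfolding P'_def P_def S_def aligned_def y_def[symmetric] by (metis (mono_tags, lifting) add_0 mem_Collect_eq)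
      qed
      from closed_walk_from_window[OF N P' this] show ?thesis unfolding P'_def by blast
    qed
  qed
  then obtain v where v: "periodic N v" "\<And>k. v k \<in> S" "\<And>k. P k (v k) (v (Suc k))" by blast
  have "periodic N (\<lambda>k w. aligned n (L k) (R k) (v k) (v (Suc k)) w)"
    using pL pR v(1) periodic_Suc[OF v(1)] unfolding twisted_periodic_def by simp
  from periodic_choice[OF this] v(3) obtain w where
    "periodic N w" "\<forall>k. aligned n (L k) (R k) (v k) (v (Suc k)) (w k)" unfolding P_def by blast
  thus ?thesis using v unfolding S_def by blast
qed

section \<open>The periodic Schur form\<close>

definition bordered :: "nat \<Rightarrow> complex mat \<Rightarrow> complex mat" where
  "bordered n M = four_block_mat (1\<^sub>m 1) (0\<^sub>m 1 n) (0\<^sub>m n 1) M"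

lemma bordered_carrier: "M \<in> carrier_mat n n \<Longrightarrow> bordered n M \<in> carrier_mat (Suc n) (Suc n)"
  unfolding bordered_def using four_block_carrier_mat[of "1\<^sub>m 1" 1 1 M n n] by simp

lemma det_bordered: "M \<in> carrier_mat n n \<Longrightarrow> det (bordered n M) = det M"
  unfolding bordered_def by (subst det_four_block_mat_lower_left_zero[of _ 1 _ n]) auto

definition lower_right :: "nat \<Rightarrow> complex mat \<Rightarrow> complex mat" where
  "lower_right n T = mat n n (\<lambda>(i, j). T $$ (Suc i, Suc j))"

text \<open>A matrix that maps the first unit vector to a multiple of itself is block upper triangular with a leading
\<open>1 \<times> 1\<close> block, so triangularizing the trailing block is enough.\<close>
lemma upper_triangular_deflation:
  assumes T: "T \<in> carrier_mat (Suc n) (Suc n)" and T0: "T *\<^sub>v unit_vec (Suc n) 0 = a \<cdot>\<^sub>v unit_vec (Suc n) 0"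
    and Q: "Q \<in> carrier_mat n n" and Z: "Z \<in> carrier_mat n n"
    and ut: "upper_triangular (Q * lower_right n T * Z)"
  shows "upper_triangular (bordered n Q * T * bordered n Z)"
proof -
  define A1 where "A1 = mat 1 1 (\<lambda>_. a)"
  define A2 where "A2 = mat 1 n (\<lambda>(i, j). T $$ (0, Suc j))"
  have A: "A1 \<in> carrier_mat 1 1" "A2 \<in> carrier_mat 1 n" "lower_right n T \<in> carrier_mat n n"
    unfolding A1_def A2_def lower_right_def by auto
  have c: "T $$ (i, 0) = (if i = 0 then a else 0)" if "i < Suc n" for i
  proof -
    have "T $$ (i, 0) = (T *\<^sub>v unit_vec (Suc n) 0) $ i"
      using that T mult_mat_unit_vec[OF T, of 0] by simp
    thus ?thesis unfolding T0 using that by simp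
  qed
  have blk: "T = four_block_mat A1 A2 (0\<^sub>m n 1) (lower_right n T)"
    by (rule eq_matI) (use T c A in \<open>auto simp: A1_def A2_def lower_right_def\<close>)
  have "bordered n Q * T = four_block_mat A1 A2 (0\<^sub>m n 1) (Q * lower_right n T)"
    unfolding bordered_def by (subst blk, subst mult_four_block_mat[of _ 1 1 _ n _ n]) (use A Q in auto)
  moreover have "four_block_mat A1 A2 (0\<^sub>m n 1) (Q * lower_right n T) * bordered n Z =
      four_block_mat A1 (A2 * Z) (0\<^sub>m n 1) (Q * lower_right n T * Z)"
    unfolding bordered_def by (subst mult_four_block_mat[of _ 1 1 _ n _ n]) (use A Q Z in auto)
  ultimately have "bordered n Q * T * bordered n Z =
      four_block_mat A1 (A2 * Z) (0\<^sub>m n 1) (Q * lower_right n T * Z)" by simp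
  moreover have "upper_triangular A1" using A by (auto simp: upper_triangular_def)
  ultimately show ?thesis
    using upper_triangular_four_block[OF A(1) mult_carrier_mat[OF mult_carrier_mat[OF Q A(3)] Z] _ ut] by simp
qed

text \<open>Induction on the size: a periodic family of aligned vectors splits off one dimension from all matrices
simultaneously.\<close>
theorem periodic_Schur_form:
  fixes L R :: "nat \<Rightarrow> complex mat"
  assumes N: "N \<ge> 1" and "periodic N L" "periodic N R"
    and "\<And>k. L k \<in> carrier_mat n n" "\<And>k. R k \<in> carrier_mat n n"
  shows "\<exists>Q Z. periodic N Q \<and> periodic N Z \<and>
    (\<forall>k. Q k \<in> carrier_mat n n \<and> Z k \<in> carrier_mat n n \<and> det (Q k) \<noteq> 0 \<and> det (Z k) \<noteq> 0 \<and>
       upper_triangular (Q k * L k * Z k) \<and> upper_triangular (Q k * R k * Z (Suc k)))"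
  using assms(2-)
proof (induction n arbitrary: L R)
  case 0
  show ?case
    by (rule exI[of _ "\<lambda>_. 1\<^sub>m 0"], rule exI[of _ "\<lambda>_. 1\<^sub>m 0"])
      (use 0 in \<open>auto simp: twisted_periodic_def upper_triangular_def\<close>)
next
  case (Suc n)
  note pL = Suc.prems(1) and pR = Suc.prems(2) and L = Suc.prems(3) and R = Suc.prems(4)
  obtain v w where pv: "periodic N v" and pw: "periodic N w"
    and v: "\<And>k. v k \<in> carrier_vec (Suc n)" "\<And>k. v k \<noteq> 0\<^sub>v (Suc n)"
    and al: "\<And>k. aligned (Suc n) (L k) (R k) (v k) (v (Suc k)) (w k)"
    using periodic_aligned_vectors[OF N _ pL pR L R] by blast
  have w: "w k \<in> carrier_vec (Suc n)" "w k \<noteq> 0\<^sub>v (Suc n)" for k using al unfolding aligned_def by auto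
  let ?e = "unit_vec (Suc n) 0 :: complex vec"
  have "\<exists>Z'. periodic N Z' \<and> (\<forall>k. Z' k \<in> carrier_mat (Suc n) (Suc n) \<and> det (Z' k) \<noteq> 0 \<and> Z' k *\<^sub>v ?e = v k)"
    by (rule periodic_choice)
      (use pv matrix_with_first_column[OF v] in \<open>auto simp: twisted_periodic_def\<close>)
  then obtain Z' where pZ': "periodic N Z'" and Z': "\<And>k. Z' k \<in> carrier_mat (Suc n) (Suc n)"
    "\<And>k. det (Z' k) \<noteq> 0" "\<And>k. Z' k *\<^sub>v ?e = v k" by blast
  have "\<exists>Q. Q \<in> carrier_mat (Suc n) (Suc n) \<and> det Q \<noteq> 0 \<and> Q *\<^sub>v w k = ?e" for k
  proof -
    obtain W where W: "W \<in> carrier_mat (Suc n) (Suc n)" "det W \<noteq> 0" "W *\<^sub>v ?e = w k"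
      using matrix_with_first_column[OF w] by blast
    obtain Q where Q: "Q \<in> carrier_mat (Suc n) (Suc n)" "det Q \<noteq> 0" "Q * W = 1\<^sub>m (Suc n)"
      using det_nonzero_inverse[OF W(1,2)] by blast
    have "Q *\<^sub>v w k = ?e" using assoc_mult_mat_vec[OF Q(1) W(1), of ?e] Q W by simp
    thus ?thesis using Q by blast
  qed
  hence "\<exists>Q'. periodic N Q' \<and> (\<forall>k. Q' k \<in> carrier_mat (Suc n) (Suc n) \<and> det (Q' k) \<noteq> 0 \<and> Q' k *\<^sub>v w k = ?e)"
    by (intro periodic_choice) (use pw in \<open>auto simp: twisted_periodic_def\<close>)
  then obtain Q' where pQ': "periodic N Q'" and Q': "\<And>k. Q' k \<in> carrier_mat (Suc n) (Suc n)"
    "\<And>k. det (Q' k) \<noteq> 0" "\<And>k. Q' k *\<^sub>v w k = ?e" by blast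
  define T where "T = (\<lambda>k. Q' k * L k * Z' k)"
  define U where "U = (\<lambda>k. Q' k * R k * Z' (Suc k))"
  have pT: "periodic N T" "periodic N U" unfolding T_def U_def using pQ' pZ' pL pR periodic_Suc[OF pZ']
    unfolding twisted_periodic_def by simp_all
  have T: "T k \<in> carrier_mat (Suc n) (Suc n)" "U k \<in> carrier_mat (Suc n) (Suc n)" for k
    unfolding T_def U_def
    by (rule mult_carrier_mat[OF mult_carrier_mat[OF Q'(1) L] Z'(1)],
        rule mult_carrier_mat[OF mult_carrier_mat[OF Q'(1) R] Z'(1)])
  have first: "\<exists>a. (Q' k * M * Z' l) *\<^sub>v ?e = a \<cdot>\<^sub>v ?e"
    if M: "M \<in> carrier_mat (Suc n) (Suc n)" and a: "M *\<^sub>v v l = a \<cdot>\<^sub>v w k" for M k l a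
  proof -
    have "(Q' k * M * Z' l) *\<^sub>v ?e = (Q' k * M) *\<^sub>v v l"
      using assoc_mult_mat_vec[OF mult_carrier_mat[OF Q'(1) M] Z'(1), of ?e k l] Z'(3) by simp
    also have "\<dots> = Q' k *\<^sub>v (M *\<^sub>v v l)" by (rule assoc_mult_mat_vec[OF Q'(1) M v(1)])
    also have "\<dots> = a \<cdot>\<^sub>v ?e" unfolding a using mult_mat_vec[OF Q'(1) w(1)] Q'(3) by simp
    finally show ?thesis by blast
  qed
  have T1: "\<exists>a. T k *\<^sub>v ?e = a \<cdot>\<^sub>v ?e" "\<exists>a. U k *\<^sub>v ?e = a \<cdot>\<^sub>v ?e" for k
    using first[OF L] first[OF R] al[of k] unfolding T_def U_def aligned_def by blast+
  have "\<exists>Q Z. periodic N Q \<and> periodic N Z \<and>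
    (\<forall>k. Q k \<in> carrier_mat n n \<and> Z k \<in> carrier_mat n n \<and> det (Q k) \<noteq> 0 \<and> det (Z k) \<noteq> 0 \<and>
       upper_triangular (Q k * lower_right n (T k) * Z k) \<and> upper_triangular (Q k * lower_right n (U k) * Z (Suc k)))"
    by (rule Suc.IH) (use pT in \<open>auto simp: twisted_periodic_def lower_right_def\<close>)
  then obtain Q Z where pQ: "periodic N Q" and pZ: "periodic N Z"
    and QZ: "\<And>k. Q k \<in> carrier_mat n n" "\<And>k. Z k \<in> carrier_mat n n" "\<And>k. det (Q k) \<noteq> 0" "\<And>k. det (Z k) \<noteq> 0"
    and ut: "\<And>k. upper_triangular (Q k * lower_right n (T k) * Z k)"
      "\<And>k. upper_triangular (Q k * lower_right n (U k) * Z (Suc k))" by blast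
  define Q2 where "Q2 = (\<lambda>k. bordered n (Q k) * Q' k)"
  define Z2 where "Z2 = (\<lambda>k. Z' k * bordered n (Z k))"
  have p2: "periodic N Q2" "periodic N Z2" using pQ pZ pQ' pZ' unfolding twisted_periodic_def Q2_def Z2_def by simp_all
  have bc: "bordered n (Q k) \<in> carrier_mat (Suc n) (Suc n)" "bordered n (Z k) \<in> carrier_mat (Suc n) (Suc n)" for k
    using QZ bordered_carrier by auto
  have c2: "Q2 k \<in> carrier_mat (Suc n) (Suc n)" "Z2 k \<in> carrier_mat (Suc n) (Suc n)" for k
    unfolding Q2_def Z2_def by (rule mult_carrier_mat[OF bc(1) Q'(1)], rule mult_carrier_mat[OF Z'(1) bc(2)])
  have d2: "det (Q2 k) \<noteq> 0" "det (Z2 k) \<noteq> 0" for k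
    unfolding Q2_def Z2_def
    using det_mult[OF bc(1) Q'(1)] det_mult[OF Z'(1) bc(2)] det_bordered QZ Q'(2) Z'(2) by auto
  have regroup: "Q2 k * M * Z2 l = bordered n (Q k) * (Q' k * M * Z' l) * bordered n (Z l)"
    if M: "M \<in> carrier_mat (Suc n) (Suc n)" for M k l
  proof -
    note QM = mult_carrier_mat[OF Q'(1)[of k] M]
    have "Q2 k * M * Z2 l = (bordered n (Q k) * (Q' k * M)) * (Z' l * bordered n (Z l))"
      unfolding Q2_def Z2_def by (simp only: assoc_mult_mat[OF bc(1) Q'(1) M])
    also have "\<dots> = (bordered n (Q k) * (Q' k * M)) * Z' l * bordered n (Z l)"
      by (rule assoc_mult_mat[OF mult_carrier_mat[OF bc(1) QM] Z'(1) bc(2), symmetric])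
    also have "\<dots> = bordered n (Q k) * (Q' k * M * Z' l) * bordered n (Z l)"
      by (simp only: assoc_mult_mat[OF bc(1) QM Z'(1)])
    finally show ?thesis .
  qed
  have TU: "Q' k * L k * Z' k = T k" "Q' k * R k * Z' (Suc k) = U k" for k
    unfolding T_def U_def by simp_all
  have ut2: "upper_triangular (Q2 k * L k * Z2 k)" "upper_triangular (Q2 k * R k * Z2 (Suc k))" for k
  proof -
    obtain a b where ab: "T k *\<^sub>v ?e = a \<cdot>\<^sub>v ?e" "U k *\<^sub>v ?e = b \<cdot>\<^sub>v ?e" using T1 by blast
    show "upper_triangular (Q2 k * L k * Z2 k)" unfolding regroup[OF L] TU
      by (rule upper_triangular_deflation[OF T(1) ab(1) QZ(1,2) ut(1)])
    show "upper_triangular (Q2 k * R k * Z2 (Suc k))" unfolding regroup[OF R] TU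
      by (rule upper_triangular_deflation[OF T(2) ab(2) QZ(1,2) ut(2)])
  qed
  show ?case
    by (rule exI[of _ Q2], rule exI[of _ Z2]) (intro conjI allI p2 c2 d2 ut2)
qed

section \<open>Systems with triangular coefficients\<close>

locale triangular_cyclic_pair = cyclic_pair +
  assumes utL: "\<And>k. upper_triangular (L k)" and utR: "\<And>k. upper_triangular (R k)"
begin

text \<open>The coefficients of the entries \<open>(i, j)\<close> of \<open>Y\<^sub>k\<close> and \<open>Y\<^sub>k\<^sub>+\<^sub>1\<close> in the entry \<open>(i, j)\<close> of the \<open>k\<close>-th equation.\<close>
definition left_coeff :: "nat \<Rightarrow> nat \<Rightarrow> nat \<Rightarrow> complex" where
  "left_coeff i j k = L k $$ (i, i) * conj_by s (L (k + r) $$ (j, j))"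

definition right_coeff :: "nat \<Rightarrow> nat \<Rightarrow> nat \<Rightarrow> complex" where
  "right_coeff i j k = R k $$ (i, i) * conj_by s (R (k + r) $$ (j, j))"

text \<open>The relation \<open>Y\<^sub>k\<^sub>+\<^sub>r = Y\<^sub>k\<^sup>\<star>\<close> exchanges the entries \<open>(i, j)\<close> and \<open>(j, i)\<close>. Off the diagonal, following one
entry through the cycle therefore takes \<open>2r\<close> steps and ends without a star, while a diagonal entry comes
back starred after \<open>r\<close> steps.\<close>
definition twist_period :: "nat \<Rightarrow> nat \<Rightarrow> nat" where "twist_period i j = (if i = j then r else 2 * r)"
definition twist_kind :: "nat \<Rightarrow> nat \<Rightarrow> star_kind" where "twist_kind i j = (if i = j then s else Transp)"

definition nondegenerate_at :: "nat \<Rightarrow> nat \<Rightarrow> bool" where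
  "nondegenerate_at i j \<longleftrightarrow> nondegenerate (twist_kind i j) (\<Prod>k<twist_period i j. left_coeff i j k) (\<Prod>k<twist_period i j. right_coeff i j k)"

lemma left_coeff_swap: "left_coeff i j (k + r) = conj_by s (left_coeff j i k)"
  and right_coeff_swap: "right_coeff i j (k + r) = conj_by s (right_coeff j i k)"
  unfolding left_coeff_def right_coeff_def by (simp_all add: L_shift_twice R_shift_twice mult.commute)

lemma twist_period_pos: "twist_period i j \<ge> 1" using r unfolding twist_period_def by simp

lemma twisted_entries:
  assumes "\<And>k. f i j (k + r) = conj_by s (f j i k)" "\<And>k. f j i (k + r) = conj_by s (f i j k)"
  shows "twisted_periodic (twist_period i j) (conj_by (twist_kind i j)) (f i j)"
proof (cases "i = j")
  case False
  have "f i j (k + 2 * r) = f i j k" for k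
    using assms by (simp add: mult_2 add.assoc[symmetric])
  thus ?thesis using False unfolding twisted_periodic_def twist_period_def twist_kind_def by simp
qed (use assms in \<open>auto simp: twisted_periodic_def twist_period_def twist_kind_def\<close>)

lemma twisted_left_coeff: "twisted_periodic (twist_period i j) (conj_by (twist_kind i j)) (left_coeff i j)"
  and twisted_right_coeff: "twisted_periodic (twist_period i j) (conj_by (twist_kind i j)) (right_coeff i j)"
  by (rule twisted_entries; rule left_coeff_swap right_coeff_swap)+

lemma twisted_SF:
  assumes "Y \<in> SF" "i < n" "j < n"
  shows "twisted_periodic (twist_period i j) (conj_by (twist_kind i j)) (\<lambda>k. Y k $$ (i, j))"
  using twisted_entries[of "\<lambda>i j k. Y k $$ (i, j)" i j] SF_shift_index assms by simp

text \<open>In \<open>(M Y N\<^sup>\<star>)\<^sub>i\<^sub>j\<close>, which is the sum of \<open>M\<^sub>i\<^sub>a Y\<^sub>a\<^sub>b N\<^sub>j\<^sub>b\<^sup>\<star>\<close>, only indices \<open>a \<ge> i\<close> and \<open>b \<ge> j\<close> occur.\<close>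
lemma triangular_congruence_entry:
  assumes M: "M \<in> carrier_mat n n" "upper_triangular M" and N: "N \<in> carrier_mat n n" "upper_triangular N"
    and Y: "Y \<in> carrier_mat n n" "Y' \<in> carrier_mat n n" and ij: "i < n" "j < n"
    and agree: "\<And>a b. \<lbrakk>a < n; b < n; i \<le> a; j \<le> b; (a, b) \<noteq> (i, j)\<rbrakk> \<Longrightarrow> Y $$ (a, b) = Y' $$ (a, b)"
  shows "(M * Y * star N) $$ (i, j) - (M * Y' * star N) $$ (i, j) =
    M $$ (i, i) * conj_by s (N $$ (j, j)) * (Y $$ (i, j) - Y' $$ (i, j))"
proof -
  define t where "t = (\<lambda>b a. M $$ (i, a) * (Y $$ (a, b) - Y' $$ (a, b)) * conj_by s (N $$ (j, b)))"
  have entry: "(M * X * star N) $$ (i, j) = (\<Sum>b<n. \<Sum>a<n. M $$ (i, a) * X $$ (a, b) * conj_by s (N $$ (j, b)))"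
    if "X \<in> carrier_mat n n" for X
  proof -
    have "(M * X * star N) $$ (i, j) = (\<Sum>b<n. (M * X) $$ (i, b) * star N $$ (b, j))"
      by (rule mult_mat_entry) (use that M N ij in auto)
    also have "\<dots> = (\<Sum>b<n. (\<Sum>a<n. M $$ (i, a) * X $$ (a, b)) * conj_by s (N $$ (j, b)))"
      using that M N ij by (intro sum.cong refl) (simp add: mult_mat_entry[of _ n] star_mat_index[of _ n] del: index_mult_mat(1))
    finally show ?thesis by (simp add: sum_distrib_right)
  qed
  have "t b a = (if b = j then if a = i then t j i else 0 else 0)" if ab: "a < n" "b < n" for a b
  proof (cases "(a, b) = (i, j)")
    case False
    have "t b a = 0"
    proof (cases "a < i \<or> b < j")
      case True
      hence "M $$ (i, a) = 0 \<or> N $$ (j, b) = 0"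
        using upper_triangularD[OF M(2)] upper_triangularD[OF N(2)] M(1) N(1) ij by auto
      thus ?thesis unfolding t_def by auto
    next
      case F: False
      hence "Y $$ (a, b) = Y' $$ (a, b)" using agree[OF ab] False by simp
      thus ?thesis unfolding t_def by simp
    qed
    thus ?thesis using False by auto
  qed simp
  hence "(\<Sum>b<n. \<Sum>a<n. t b a) = (\<Sum>b<n. \<Sum>a<n. if b = j then if a = i then t j i else 0 else 0)"
    by (intro sum.cong refl) auto
  also have "\<dots> = (\<Sum>b<n. if b = j then \<Sum>a<n. if a = i then t j i else 0 else 0)"
    by (intro sum.cong refl) auto
  also have "\<dots> = t j i" using ij by simp
  finally have "(\<Sum>b<n. \<Sum>a<n. t b a) = t j i" .
  thus ?thesis unfolding entry[OF Y(1)] entry[OF Y(2)] t_def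
    by (simp add: sum_subtractf[symmetric] algebra_simps)
qed

text \<open>The sum \<open>i + j\<close> serves as the level of an entry: every entry on which the \<open>(i, j)\<close> entries of the equations
depend, except for \<open>(i, j)\<close> itself, has a larger level, and the level is the same for \<open>(i, j)\<close> and \<open>(j, i)\<close>, which
are coupled by \<open>\<star>\<close>.\<close>
lemma syl_entry_diff:
  assumes Y: "Y \<in> SF" "Y' \<in> SF" and ij: "i < n" "j < n"
    and agree: "\<And>k a b. \<lbrakk>a < n; b < n; i + j < a + b\<rbrakk> \<Longrightarrow> Y k $$ (a, b) = Y' k $$ (a, b)"
  shows "syl Y k $$ (i, j) - syl Y' k $$ (i, j) =
    left_coeff i j k * (Y k $$ (i, j) - Y' k $$ (i, j)) - right_coeff i j k * (Y (Suc k) $$ (i, j) - Y' (Suc k) $$ (i, j))"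
proof -
  have ag: "Y k $$ (a, b) = Y' k $$ (a, b)" if "a < n" "b < n" "i \<le> a" "j \<le> b" "(a, b) \<noteq> (i, j)" for a b k
  proof -
    have "i + j < a + b" using that by auto
    thus ?thesis using agree that by blast
  qed
  have ent: "syl X k $$ (i, j) = (L k * X k * star (L (k + r))) $$ (i, j) - (R k * X (Suc k) * star (R (k + r))) $$ (i, j)"
    if "X \<in> SF" for X
  proof -
    have "R k * X (Suc k) * star (R (k + r)) \<in> carrier_mat n n" using that by simp
    thus ?thesis unfolding sylvester_map_def using ij by (intro index_minus_mat) auto
  qed
  show ?thesis
    unfolding ent[OF Y(1)] ent[OF Y(2)] left_coeff_def right_coeff_def
    using triangular_congruence_entry[OF L[of k] utL[of k] L[of "k + r"] utL[of "k + r"]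
        SF_carrier[OF Y(1), of k] SF_carrier[OF Y(2), of k] ij ag]
      triangular_congruence_entry[OF R[of k] utR[of k] R[of "k + r"] utR[of "k + r"]
        SF_carrier[OF Y(1), of "Suc k"] SF_carrier[OF Y(2), of "Suc k"] ij ag]
    by (simp add: algebra_simps)
qed

text \<open>Back substitution, one level at a time: changing the entries of level \<open>t\<close> repairs the equations of that level
and leaves those of higher levels intact. Starting below an arbitrary level \<open>t\<close> yields both the existence of
solutions and the extension of kernel elements that are found at a level \<open>t\<close>.\<close>
lemma extend_solution:
  assumes "\<And>i j. \<lbrakk>i < n; j < n; i + j < t\<rbrakk> \<Longrightarrow> nondegenerate_at i j"
    and "Y \<in> SF" and E: "E \<in> SF"
    and "\<And>k i j. \<lbrakk>i < n; j < n; t \<le> i + j\<rbrakk> \<Longrightarrow> syl Y k $$ (i, j) = E k $$ (i, j)"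
  shows "\<exists>Y'\<in>SF. (\<forall>k. syl Y' k = E k) \<and>
    (\<forall>k i j. i < n \<longrightarrow> j < n \<longrightarrow> t \<le> i + j \<longrightarrow> Y' k $$ (i, j) = Y k $$ (i, j))"
  using assms(1,2,4)
proof (induction t arbitrary: Y)
  case 0
  have "syl Y k = E k" for k
    by (rule eq_matI) (use 0 SF_carrier[OF syl_in_SF[OF 0(2)], of k] SF_carrier[OF E, of k] in auto)
  thus ?case using 0 by blast
next
  case (Suc t)
  note Y = Suc.prems(2)
  define g where "g = (\<lambda>i j k. E k $$ (i, j) - syl Y k $$ (i, j))"
  have g_swap: "g i j (k + r) = conj_by s (g j i k)" if "i < n" "j < n" for i j k
    unfolding g_def using SF_shift_index[OF E] SF_shift_index[OF syl_in_SF[OF Y]] that by simp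
  have "\<exists>u. solves_cyclic (twist_period i j) (twist_kind i j) (left_coeff i j) (right_coeff i j) (g i j) u"
    if "i < n" "j < n" "i + j = t" for i j
  proof (rule cyclic_solvable[OF twist_period_pos twisted_left_coeff twisted_right_coeff])
    show "nondegenerate (twist_kind i j) (prod (left_coeff i j) {..<twist_period i j}) (prod (right_coeff i j) {..<twist_period i j})"
      using Suc.prems(1)[of i j] that unfolding nondegenerate_at_def by simp
    show "twisted_periodic (twist_period i j) (conj_by (twist_kind i j)) (g i j)"
      by (rule twisted_entries) (use that g_swap in auto)
  qed
  then obtain w where w: "\<And>i j. \<lbrakk>i < n; j < n; i + j = t\<rbrakk> \<Longrightarrow>
      solves_cyclic (twist_period i j) (twist_kind i j) (left_coeff i j) (right_coeff i j) (g i j) (w i j)" by metis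
  \<comment> \<open>The two entries of an off-diagonal pair must not be corrected independently: the lower one is determined
    by the upper one through \<open>\<star>\<close>.\<close>
  define v where "v = (\<lambda>i j k. if i \<le> j then w i j k else conj_by s (w j i (k + r)))"
  have v_swap: "v i j (k + r) = conj_by s (v j i k)" if ij: "i < n" "j < n" "i + j = t" for i j k
  proof -
    consider "i = j" | "i < j" | "j < i" by linarith
    thus ?thesis
    proof cases
      case 1
      thus ?thesis using w[OF ij] unfolding v_def solves_cyclic_def twisted_periodic_def twist_period_def twist_kind_def by simp
    next
      case 2
      thus ?thesis unfolding v_def by simp
    next
      case 3
      have "w j i (k + 2 * r) = w j i k"
        using w[of j i] ij 3 unfolding solves_cyclic_def twisted_periodic_def twist_period_def twist_kind_def by auto
      hence "w j i (k + r + r) = w j i k" by (simp add: mult_2 add.assoc)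
      thus ?thesis using 3 unfolding v_def by simp
    qed
  qed
  have v_eq: "left_coeff i j k * v i j k - right_coeff i j k * v i j (Suc k) = g i j k" if ij: "i < n" "j < n" "i + j = t" for i j k
  proof (cases "i \<le> j")
    case True
    thus ?thesis using w[OF ij] unfolding v_def solves_cyclic_def by simp
  next
    case False
    have "conj_by s (left_coeff j i (k + r) * w j i (k + r) - right_coeff j i (k + r) * w j i (Suc (k + r))) = conj_by s (g j i (k + r))"
      using w[of j i] ij unfolding solves_cyclic_def by (simp add: add.commute)
    thus ?thesis using False g_swap[of j i k] ij unfolding v_def by (simp add: left_coeff_swap right_coeff_swap)
  qed
  define Y1 where "Y1 = (\<lambda>k. mat n n (\<lambda>(i, j). Y k $$ (i, j) + (if i + j = t then v i j k else 0)))"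
  have Y1i: "Y1 k $$ (i, j) = Y k $$ (i, j) + (if i + j = t then v i j k else 0)" if "i < n" "j < n" for k i j
    using that unfolding Y1_def by simp
  have Y1: "Y1 \<in> SF"
    by (rule SF_I) (use Y v_swap in \<open>auto simp: Y1i SF_shift_index add.commute\<close>, simp add: Y1_def)
  have "syl Y1 k $$ (i, j) = E k $$ (i, j)" if ij: "i < n" "j < n" "t \<le> i + j" for k i j
  proof -
    have "syl Y1 k $$ (i, j) - syl Y k $$ (i, j) =
      left_coeff i j k * (Y1 k $$ (i, j) - Y k $$ (i, j)) - right_coeff i j k * (Y1 (Suc k) $$ (i, j) - Y (Suc k) $$ (i, j))"
      by (rule syl_entry_diff[OF Y1 Y ij(1,2)]) (use ij Y1i in auto)
    also have "\<dots> = (if i + j = t then g i j k else 0)" using v_eq ij Y1i by simp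
    also have "\<dots> = E k $$ (i, j) - syl Y k $$ (i, j)"
      using Suc.prems(3)[OF ij(1,2), of k] ij(3) unfolding g_def by auto
    finally show ?thesis by simp
  qed
  from Suc.IH[OF Suc.prems(1) Y1 this] obtain Y' where Y': "Y' \<in> SF" "\<forall>k. syl Y' k = E k"
    "\<forall>k i j. i < n \<longrightarrow> j < n \<longrightarrow> t \<le> i + j \<longrightarrow> Y' k $$ (i, j) = Y1 k $$ (i, j)" by auto
  moreover have "Y' k $$ (i, j) = Y k $$ (i, j)" if "i < n" "j < n" "Suc t \<le> i + j" for k i j
    using Y'(3) that Y1i by auto
  ultimately show ?case by blast
qed

lemma zero_in_SF: "(\<lambda>_. 0\<^sub>m n n) \<in> SF"
  by (rule SF_I) auto

lemma syl_zero: "syl (\<lambda>_. 0\<^sub>m n n) k = 0\<^sub>m n n"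
proof -
  have c: "L k \<in> carrier_mat n n" "R k \<in> carrier_mat n n" "star (L (k + r)) \<in> carrier_mat n n" "star (R (k + r)) \<in> carrier_mat n n"
    by auto
  have "L k * 0\<^sub>m n n * star (L (k + r)) = 0\<^sub>m n n" "R k * 0\<^sub>m n n * star (R (k + r)) = 0\<^sub>m n n"
    using c by (simp_all add: right_mult_zero_mat[of _ n n] left_mult_zero_mat[of _ n n])
  thus ?thesis unfolding sylvester_map_def by (auto intro!: eq_matI)
qed

lemma solution_unique:
  assumes nondegenerate_at: "\<And>i j. \<lbrakk>i < n; j < n\<rbrakk> \<Longrightarrow> nondegenerate_at i j"
    and Y: "Y \<in> SF" "Y' \<in> SF" and eq: "\<And>k. syl Y k = syl Y' k"
  shows "Y = Y'"
proof -
  have "\<forall>k. Y k $$ (i, j) = Y' k $$ (i, j)" if "i < n" "j < n" for i j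
    using that
  proof (induction "2 * n - (i + j)" arbitrary: i j rule: less_induct)
    case less
    have ag: "Y k $$ (a, b) = Y' k $$ (a, b)" if "a < n" "b < n" "i + j < a + b" for k a b
      using less.hyps[of a b] that by auto
    define d where "d = (\<lambda>k. Y k $$ (i, j) - Y' k $$ (i, j))"
    have "left_coeff i j k * d k - right_coeff i j k * d (Suc k) = 0" for k
      using syl_entry_diff[OF Y less.prems ag, of k] eq[of k] unfolding d_def by simp
    moreover have "twisted_periodic (twist_period i j) (conj_by (twist_kind i j)) d"
      using twisted_SF[OF Y(1) less.prems] twisted_SF[OF Y(2) less.prems] unfolding d_def twisted_periodic_def by simp
    ultimately have "solves_cyclic (twist_period i j) (twist_kind i j) (left_coeff i j) (right_coeff i j) (\<lambda>_. 0) d"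
      unfolding solves_cyclic_def by simp
    hence "d k = 0" for k
      using cyclic_unique[OF twist_period_pos twisted_left_coeff twisted_right_coeff] nondegenerate_at[OF less.prems] unfolding nondegenerate_at_def by blast
    thus ?case unfolding d_def by simp
  qed
  hence "Y k = Y' k" for k
    by (intro eq_matI) (use SF_carrier[OF Y(1), of k] SF_carrier[OF Y(2), of k] in auto)
  thus ?thesis by blast
qed

text \<open>Take a degenerate pair of least level \<open>t\<close>. A kernel element of its scalar system, placed at \<open>(i, j)\<close> and, starred,
at \<open>(j, i)\<close>, satisfies the homogeneous equations of all levels \<open>\<ge> t\<close>; the pairs of lower level are
nondegenerate, so that it extends to a kernel element of the whole system.\<close>
lemma kernel_exists:
  assumes "i < n" "j < n" "\<not> nondegenerate_at i j"
  shows "\<exists>Y\<in>SF. (\<forall>k. syl Y k = 0\<^sub>m n n) \<and> Y \<noteq> (\<lambda>_. 0\<^sub>m n n)"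
proof -
  define bad where "bad = (\<lambda>t. \<exists>i j. i < n \<and> j < n \<and> \<not> nondegenerate_at i j \<and> i + j = t)"
  define t where "t = (LEAST t. bad t)"
  have "bad (i + j)" using assms unfolding bad_def by blast
  hence "bad t" unfolding t_def by (rule LeastI)
  then obtain i j where ij: "i < n" "j < n" "i + j = t" and ng: "\<not> nondegenerate_at i j" unfolding bad_def by blast
  have below: "nondegenerate_at a b" if "a < n" "b < n" "a + b < t" for a b
    using not_less_Least[of "a + b" bad] that unfolding t_def bad_def by blast
  obtain u k0 where u: "solves_cyclic (twist_period i j) (twist_kind i j) (left_coeff i j) (right_coeff i j) (\<lambda>_. 0) u" and k0: "u k0 \<noteq> 0"
    using cyclic_kernel[OF twist_period_pos twisted_left_coeff twisted_right_coeff] ng unfolding nondegenerate_at_def by blast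
  have ueq: "left_coeff i j k * u k = right_coeff i j k * u (Suc k)" for k using u unfolding solves_cyclic_def by simp
  have per_u: "i = j \<Longrightarrow> u (k + r) = conj_by s (u k)" for k
    using u unfolding solves_cyclic_def twisted_periodic_def twist_period_def twist_kind_def by auto
  have per_u2: "u (k + r + r) = u k" if "i \<noteq> j" for k
  proof -
    have "u (k + 2 * r) = u k" using u that unfolding solves_cyclic_def twisted_periodic_def twist_period_def twist_kind_def by auto
    moreover have "k + r + r = k + 2 * r" by simp
    ultimately show ?thesis by metis
  qed
  define e where "e = (\<lambda>k a b. if (a, b) = (i, j) then u k else if (a, b) = (j, i) then conj_by s (u (k + r)) else 0)"
  define Y where "Y = (\<lambda>k. mat n n (\<lambda>(a, b). e k a b))"
  have Yi: "Y k $$ (a, b) = e k a b" if "a < n" "b < n" for k a b using that unfolding Y_def by simp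
  have e_swap: "e (k + r) a b = conj_by s (e k b a)" for k a b
  proof (cases "i = j")
    case True
    thus ?thesis using per_u[OF True, of k] unfolding e_def by simp
  next
    case False
    thus ?thesis using per_u2[OF False, of k] unfolding e_def by simp
  qed
  have Y: "Y \<in> SF"
    by (rule SF_I) (simp add: Y_def, simp add: Yi e_swap)
  have eeq: "left_coeff a b k * e k a b - right_coeff a b k * e (Suc k) a b = 0" for a b k
  proof -
    consider "(a, b) = (i, j)" | "(a, b) = (j, i)" "(a, b) \<noteq> (i, j)" | "(a, b) \<noteq> (i, j)" "(a, b) \<noteq> (j, i)" by blast
    thus ?thesis
    proof cases
      case 1
      thus ?thesis using ueq[of k] unfolding e_def by simp
    next
      case 2
      have "conj_by s (left_coeff i j (k + r) * u (k + r)) = conj_by s (right_coeff i j (k + r) * u (Suc (k + r)))"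
        by (simp only: ueq[of "k + r"])
      hence "left_coeff j i k * conj_by s (u (k + r)) = right_coeff j i k * conj_by s (u (Suc (k + r)))"
        by (simp add: left_coeff_swap right_coeff_swap)
      moreover have "a = j" "b = i" "i \<noteq> j" using 2 by auto
      ultimately show ?thesis unfolding e_def by simp
    next
      case 3
      hence "e k' a b = 0" for k' by (simp only: e_def if_False)
      thus ?thesis by simp
    qed
  qed
  have "syl Y k $$ (a, b) = 0\<^sub>m n n $$ (a, b)" if ab: "a < n" "b < n" "t \<le> a + b" for k a b
  proof -
    have "syl Y k $$ (a, b) - syl (\<lambda>_. 0\<^sub>m n n) k $$ (a, b) =
      left_coeff a b k * (Y k $$ (a, b) - 0\<^sub>m n n $$ (a, b)) - right_coeff a b k * (Y (Suc k) $$ (a, b) - 0\<^sub>m n n $$ (a, b))"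
      by (rule syl_entry_diff[OF Y zero_in_SF ab(1,2)]) (use ab ij in \<open>auto simp: Yi e_def\<close>)
    thus ?thesis using ab eeq by (simp add: syl_zero Yi)
  qed
  from extend_solution[OF below Y zero_in_SF this] obtain Y' where Y': "Y' \<in> SF" "\<forall>k. syl Y' k = 0\<^sub>m n n"
    "\<forall>k a b. a < n \<longrightarrow> b < n \<longrightarrow> t \<le> a + b \<longrightarrow> Y' k $$ (a, b) = Y k $$ (a, b)" by blast
  have "Y' k0 $$ (i, j) \<noteq> 0" using Y'(3) ij k0 by (simp add: Yi e_def)
  hence "Y' \<noteq> (\<lambda>_. 0\<^sub>m n n)" using ij by auto
  thus ?thesis using Y' by blast
qed

theorem doubled_nonsingular_iff_nondegenerate:
  "doubled_nonsingular s n r L R \<longleftrightarrow> (\<forall>i<n. \<forall>j<n. nondegenerate_at i j)"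
proof
  assume ns: "doubled_nonsingular s n r L R"
  show "\<forall>i<n. \<forall>j<n. nondegenerate_at i j"
  proof (rule ccontr)
    assume "\<not> (\<forall>i<n. \<forall>j<n. nondegenerate_at i j)"
    then obtain Y where Y: "Y \<in> SF" "\<forall>k. syl Y k = 0\<^sub>m n n" "Y \<noteq> (\<lambda>_. 0\<^sub>m n n)" using kernel_exists by blast
    have "\<exists>!Y. Y \<in> SF \<and> (\<forall>k. syl Y k = 0\<^sub>m n n)"
      using ns zero_in_SF unfolding doubled_nonsingular_def by fastforce
    thus False using Y zero_in_SF syl_zero by blast
  qed
next
  assume nondegenerate_at: "\<forall>i<n. \<forall>j<n. nondegenerate_at i j"
  show "doubled_nonsingular s n r L R" unfolding doubled_nonsingular_def
  proof
    fix E assume E: "E \<in> SF"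
    obtain Y where Y: "Y \<in> SF" "\<forall>k. syl Y k = E k"
      using extend_solution[of "2 * n" "\<lambda>_. 0\<^sub>m n n" E] nondegenerate_at E zero_in_SF by auto
    thus "\<exists>!Y. Y \<in> SF \<and> (\<forall>k. syl Y k = E k)"
      using solution_unique nondegenerate_at by (intro ex1I[of _ Y]) auto
  qed
qed

text \<open>These numbers are also the coefficients of the factors of the determinant of the pencil.\<close>
definition alpha :: "nat \<Rightarrow> complex" where "alpha i = (\<Prod>k<2 * r. L k $$ (i, i))"
definition gamma :: "nat \<Rightarrow> complex" where "gamma i = (\<Prod>k<2 * r. R k $$ (i, i))"

lemma prod_halves: "(\<Prod>k<2 * r. f k) = (\<Prod>k<r. f k) * (\<Prod>k<r. f (k + r))" for f :: "nat \<Rightarrow> complex"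
proof -
  have "(\<Prod>k<m + r. f k) = (\<Prod>k<r. f k) * (\<Prod>k<m. f (k + r))" for m
    by (induction m) auto
  from this[of r] show ?thesis by (simp add: mult_2)
qed

lemma prod_twisted_full:
  assumes "\<And>k. f (k + r + r) = f k" "\<And>k. g (k + r + r) = g k"
  shows "(\<Prod>k<2 * r. f k * conj_by s (g (k + r))) = (\<Prod>k<2 * r. f k) * conj_by s (\<Prod>k<2 * r. g k)"
  unfolding prod_halves by (simp add: prod.distrib assms conj_by_prod)

lemma nondegenerate_at_offdiagonal:
  assumes "i \<noteq> j"
  shows "nondegenerate_at i j \<longleftrightarrow> alpha i * conj_by s (alpha j) \<noteq> gamma i * conj_by s (gamma j)"
proof -
  have "(\<Prod>k<2 * r. left_coeff i j k) = alpha i * conj_by s (alpha j)"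
    unfolding left_coeff_def alpha_def by (rule prod_twisted_full) (simp_all only: L_shift_twice)
  moreover have "(\<Prod>k<2 * r. right_coeff i j k) = gamma i * conj_by s (gamma j)"
    unfolding right_coeff_def gamma_def by (rule prod_twisted_full) (simp_all only: R_shift_twice)
  ultimately show ?thesis using assms unfolding nondegenerate_at_def twist_kind_def twist_period_def by (simp add: nondegenerate_Transp)
qed

lemma nondegenerate_at_diagonal:
  "nondegenerate_at i i \<longleftrightarrow> (if s = Transp then alpha i \<noteq> gamma i
     else alpha i * conj_by s (alpha i) \<noteq> gamma i * conj_by s (gamma i))"
proof (cases s)
  case Transp
  thus ?thesis unfolding nondegenerate_at_def twist_kind_def twist_period_def left_coeff_def right_coeff_def alpha_def gamma_def prod_halves
    by (simp add: nondegenerate_Transp prod.distrib)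
next
  case ConjTransp
  thus ?thesis unfolding nondegenerate_at_def twist_kind_def twist_period_def left_coeff_def right_coeff_def alpha_def gamma_def prod_halves
    by (simp add: nondegenerate_ConjTransp prod.distrib ac_simps)
qed

end

section \<open>Determinants of block matrices\<close>

text \<open>A block matrix given by its entries, with block indices from \<open>0\<close>. Treating block indices and indices within
the blocks alike allows for exchanging their roles.\<close>
definition block_entries :: "nat \<Rightarrow> nat \<Rightarrow> (nat \<Rightarrow> nat \<Rightarrow> nat \<Rightarrow> nat \<Rightarrow> 'a) \<Rightarrow> 'a mat" where
  "block_entries m n f = mat (m * n) (m * n) (\<lambda>(s, t). f (s div n) (t div n) (s mod n) (t mod n))"

lemma block_entries_carrier [simp]: "block_entries m n f \<in> carrier_mat (m * n) (m * n)"
  unfolding block_entries_def by simp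

lemma block_index_less: "s < m * n \<Longrightarrow> s div n < m \<and> s mod n < (n :: nat)"
  by (cases "n = 0") (auto simp: less_mult_imp_div_less)

lemma block_split:
  fixes k n s :: nat
  assumes "k * n \<le> s" "s < k * n + n"
  shows "s div n = k" "s mod n = s - k * n"
proof -
  obtain t where "s = k * n + t" using assms(1) le_Suc_ex by blast
  thus "s div n = k" "s mod n = s - k * n" using assms(2) by auto
qed

lemma block_entries_cong:
  assumes "\<And>k l i j. \<lbrakk>k < m; l < m; i < n; j < n\<rbrakk> \<Longrightarrow> f k l i j = g k l i j"
  shows "block_entries m n f = block_entries m n g"
  unfolding block_entries_def using assms by (intro eq_matI) (auto dest!: block_index_less)

lemma det_block_entries_triangular:
  fixes f :: "nat \<Rightarrow> nat \<Rightarrow> nat \<Rightarrow> nat \<Rightarrow> 'a :: idom"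
  assumes "\<And>k l i j. \<lbrakk>l < k; k < m; i < n; j < n\<rbrakk> \<Longrightarrow> f k l i j = 0"
  shows "det (block_entries m n f) = (\<Prod>k<m. det (mat n n (\<lambda>(i, j). f k k i j)))"
  using assms
proof (induction m)
  case 0
  show ?case by (simp add: block_entries_def)
next
  case (Suc m)
  define B where "B = mat (m * n) n (\<lambda>(s, j). f (s div n) m (s mod n) j)"
  have "block_entries (Suc m) n f =
      four_block_mat (block_entries m n f) B (0\<^sub>m n (m * n)) (mat n n (\<lambda>(i, j). f m m i j))"
    by (rule eq_matI)
      (use Suc.prems in \<open>auto simp: block_entries_def B_def add.commute[of n] block_split[of m n] dest!: block_index_less\<close>)
  hence "det (block_entries (Suc m) n f) = det (block_entries m n f) * det (mat n n (\<lambda>(i, j). f m m i j))"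
    by (simp only:, intro det_four_block_mat_lower_left_zero[of _ "m * n" _ n]) (auto simp: B_def)
  also have "det (block_entries m n f) = (\<Prod>k<m. det (mat n n (\<lambda>(i, j). f k k i j)))"
    using Suc by simp
  finally show ?case by simp
qed

lemma det_permute_rows_cols:
  fixes A :: "'a :: comm_ring_1 mat"
  assumes A: "A \<in> carrier_mat n n" and p: "p permutes {0..<n}"
  shows "det (mat n n (\<lambda>(i, j). A $$ (p i, p j))) = det A"
proof -
  define B where "B = mat n n (\<lambda>(i, j). A $$ (p i, j))"
  have B: "B \<in> carrier_mat n n" unfolding B_def by simp
  have pn: "i < n \<Longrightarrow> p i < n" for i using permutes_in_image[OF p, of i] by simp
  define C where "C = mat n n (\<lambda>(i, j). transpose_mat B $$ (p i, j))"
  have C: "C \<in> carrier_mat n n" unfolding C_def by simp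
  have "mat n n (\<lambda>(i, j). A $$ (p i, p j)) = transpose_mat C"
    by (rule eq_matI) (use pn in \<open>auto simp: B_def C_def\<close>)
  hence "det (mat n n (\<lambda>(i, j). A $$ (p i, p j))) = det C" using det_transpose[OF C] by simp
  also have "\<dots> = signof p * det B"
    unfolding C_def using det_permute_rows[OF transpose_carrier_mat[THEN iffD2, OF B] p] det_transpose[OF B] by simp
  also have "\<dots> = signof p * signof p * det A"
    unfolding B_def using det_permute_rows[OF A p] by simp
  also have "signof p * signof p = (1 :: 'a)"
    by (metis of_int_1 of_int_mult sign_idempotent)
  finally show ?thesis by simp
qed

text \<open>Regard the \<open>m \<times> m\<close> array of \<open>n \<times> n\<close> blocks as an \<open>n \<times> n\<close> array of \<open>m \<times> m\<close> blocks. This is the same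
permutation (the perfect shuffle) of rows and of columns, so that its sign cancels.\<close>
lemma det_block_entries_shuffle:
  fixes f :: "nat \<Rightarrow> nat \<Rightarrow> nat \<Rightarrow> nat \<Rightarrow> 'a :: comm_ring_1"
  shows "det (block_entries m n f) = det (block_entries n m (\<lambda>i j k l. f k l i j))"
proof -
  define p where "p = (\<lambda>t. if t < m * n then (t mod m) * n + t div m else t)"
  have pb: "p t < m * n \<and> p t div n = t mod m \<and> p t mod n = t div m" if t: "t < m * n" for t
  proof -
    have d: "t div m < n" "t mod m < m" using block_index_less[of t n m] t by (auto simp: mult.commute)
    have "t mod m * n + t div m < t mod m * n + n" using d by simp
    also have "\<dots> = Suc (t mod m) * n" by simp
    also have "\<dots> \<le> m * n" using d by (intro mult_le_mono1) simp
    finally show ?thesis using t d unfolding p_def by simp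
  qed
  have "inj_on p {0..<m * n}"
    by (rule inj_onI) (metis pb atLeastLessThan_iff mult_div_mod_eq)
  moreover have "p ` {0..<m * n} \<subseteq> {0..<m * n}" using pb by auto
  ultimately have "p ` {0..<m * n} = {0..<m * n}"
    by (intro endo_inj_surj) auto
  hence "bij_betw p {0..<m * n} {0..<m * n}" using \<open>inj_on p _\<close> unfolding bij_betw_def by blast
  hence p: "p permutes {0..<m * n}" by (rule bij_imp_permutes) (auto simp: p_def)
  have "mat (m * n) (m * n) (\<lambda>(i, j). block_entries m n f $$ (p i, p j)) = block_entries n m (\<lambda>i j k l. f k l i j)"
    by (rule eq_matI) (use pb in \<open>auto simp: block_entries_def mult.commute\<close>)
  thus ?thesis using det_permute_rows_cols[OF block_entries_carrier p, of f] by simp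
qed

lemma sum_div_mod:
  fixes g :: "nat \<Rightarrow> nat \<Rightarrow> 'a :: comm_monoid_add"
  shows "(\<Sum>t<m * n. g (t div n) (t mod n)) = (\<Sum>k<m. \<Sum>i<n. g k i)"
proof -
  have "(\<Sum>t<m * n. g (t div n) (t mod n)) = (\<Sum>k<m. \<Sum>t = k * n..<k * n + n. g (t div n) (t mod n))"
    by (rule sum.nat_group[symmetric])
  moreover have "(\<Sum>t = k * n..<k * n + n. g (t div n) (t mod n)) = (\<Sum>i<n. g k i)" for k
    by (rule sum.reindex_bij_witness[of _ "\<lambda>i. k * n + i" "\<lambda>t. t - k * n"])
      (auto simp: block_split[of k n])
  ultimately show ?thesis by simp
qed

definition block_diagonal :: "nat \<Rightarrow> nat \<Rightarrow> (nat \<Rightarrow> 'a mat) \<Rightarrow> 'a :: zero mat" where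
  "block_diagonal m n P = block_entries m n (\<lambda>k l i j. if l = k then P k $$ (i, j) else 0)"

lemma block_diagonal_carrier [simp]: "block_diagonal m n P \<in> carrier_mat (m * n) (m * n)"
  unfolding block_diagonal_def by simp

lemma det_block_diagonal:
  fixes P :: "nat \<Rightarrow> 'a :: idom mat"
  assumes "\<And>k. k < m \<Longrightarrow> P k \<in> carrier_mat n n"
  shows "det (block_diagonal m n P) = (\<Prod>k<m. det (P k))"
proof -
  have "mat n n (\<lambda>(i, j). P k $$ (i, j)) = P k" if "k < m" for k
    using assms[OF that] by (intro eq_matI) auto
  thus ?thesis unfolding block_diagonal_def by (subst det_block_entries_triangular) auto
qed

lemma block_diagonal_mult_left:
  fixes f :: "nat \<Rightarrow> nat \<Rightarrow> nat \<Rightarrow> nat \<Rightarrow> 'a :: comm_ring_1"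
  shows "block_diagonal m n P * block_entries m n f =
    block_entries m n (\<lambda>k l i j. \<Sum>a<n. P k $$ (i, a) * f k l a j)" (is "?L = ?R")
proof (rule eq_matI)
  fix s t assume "s < dim_row ?R" "t < dim_col ?R"
  hence s: "s < m * n" and t: "t < m * n" unfolding block_entries_def by auto
  note b = block_index_less[OF s] block_index_less[OF t]
  have "?L $$ (s, t) = (\<Sum>u<m * n. (if u div n = s div n then P (s div n) $$ (s mod n, u mod n) else 0)
      * f (u div n) (t div n) (u mod n) (t mod n))"
    using s t by (simp add: block_diagonal_def block_entries_def scalar_prod_def lessThan_atLeast0)
  also have "\<dots> = (\<Sum>k<m. \<Sum>a<n. (if k = s div n then P (s div n) $$ (s mod n, a) else 0) * f k (t div n) a (t mod n))"
    by (rule sum_div_mod)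
  also have "\<dots> = (\<Sum>k<m. if k = s div n then \<Sum>a<n. P (s div n) $$ (s mod n, a) * f k (t div n) a (t mod n) else 0)"
    by (intro sum.cong) auto
  also have "\<dots> = ?R $$ (s, t)" using b s t by (simp add: block_entries_def)
  finally show "?L $$ (s, t) = ?R $$ (s, t)" .
qed (simp_all add: block_diagonal_def block_entries_def)

lemma block_diagonal_mult_right:
  fixes f :: "nat \<Rightarrow> nat \<Rightarrow> nat \<Rightarrow> nat \<Rightarrow> 'a :: comm_ring_1"
  shows "block_entries m n f * block_diagonal m n P =
    block_entries m n (\<lambda>k l i j. \<Sum>a<n. f k l i a * P l $$ (a, j))" (is "?L = ?R")
proof (rule eq_matI)
  fix s t assume "s < dim_row ?R" "t < dim_col ?R"
  hence s: "s < m * n" and t: "t < m * n" unfolding block_entries_def by auto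
  note b = block_index_less[OF s] block_index_less[OF t]
  have "?L $$ (s, t) = (\<Sum>u<m * n. f (s div n) (u div n) (s mod n) (u mod n) *
      (if t div n = u div n then P (u div n) $$ (u mod n, t mod n) else 0))"
    using s t by (simp add: block_diagonal_def block_entries_def scalar_prod_def lessThan_atLeast0)
  also have "\<dots> = (\<Sum>k<m. \<Sum>a<n. f (s div n) k (s mod n) a * (if t div n = k then P k $$ (a, t mod n) else 0))"
    by (rule sum_div_mod)
  also have "\<dots> = (\<Sum>k<m. if k = t div n then \<Sum>a<n. f (s div n) k (s mod n) a * P k $$ (a, t mod n) else 0)"
    by (intro sum.cong) auto
  also have "\<dots> = ?R $$ (s, t)" using b s t by (simp add: block_entries_def)
  finally show "?L $$ (s, t) = ?R $$ (s, t)" .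
qed (simp_all add: block_diagonal_def block_entries_def)

section \<open>The determinant of a cyclic pencil\<close>

definition cyclic_bidiagonal :: "nat \<Rightarrow> (nat \<Rightarrow> 'a) \<Rightarrow> (nat \<Rightarrow> 'a) \<Rightarrow> 'a \<Rightarrow> 'a :: comm_ring_1 mat" where
  "cyclic_bidiagonal m a c d = mat m m (\<lambda>(k, l).
     if l = k then a k else if l = Suc k then c k else if Suc k = m \<and> l = 0 then d else 0)"

text \<open>Expand along the first column, whose two nonzero entries have an upper and a lower triangular minor.\<close>
lemma det_cyclic_bidiagonal:
  fixes a c :: "nat \<Rightarrow> 'a :: idom"
  assumes m: "m \<ge> 2"
  shows "det (cyclic_bidiagonal m a c d) = (\<Prod>k<m. a k) + (-1) ^ (m - 1) * d * (\<Prod>k<m - 1. c k)"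
proof -
  obtain m' where m': "m = Suc m'" "m' \<ge> 1" using m by (cases m) auto
  let ?M = "cyclic_bidiagonal m a c d"
  have M: "?M \<in> carrier_mat m m" unfolding cyclic_bidiagonal_def by simp
  define U where "U = mat_delete ?M 0 0"
  define V where "V = mat_delete ?M m' 0"
  have UV: "U \<in> carrier_mat m' m'" "V \<in> carrier_mat m' m'"
    using mat_delete_carrier[OF M] unfolding U_def V_def m' by simp_all
  have dims: "dim_row ?M = Suc m'" "dim_col ?M = Suc m'" using M m' by auto
  have Uij: "U $$ (i, j) = (if j = i then a (Suc i) else if j = Suc i then c (Suc i) else 0)"
    if "i < m'" "j < m'" for i j
    using that unfolding U_def mat_delete_def dims by (simp add: cyclic_bidiagonal_def m')
  have Vij: "V $$ (i, j) = (if Suc j = i then a i else if j = i then c i else 0)"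
    if "i < m'" "j < m'" for i j
    using that unfolding V_def mat_delete_def dims by (simp add: cyclic_bidiagonal_def m')
  have "upper_triangular U" using UV Uij by (intro upper_triangularI) auto
  hence "det U = prod_list (diag_mat U)" using det_upper_triangular UV by blast
  also have "\<dots> = (\<Prod>i<m'. a (Suc i))"
    using UV Uij by (simp add: prod_list_diag_prod lessThan_atLeast0)
  finally have dU: "det U = (\<Prod>i<m'. a (Suc i))" .
  have "det V = prod_list (diag_mat V)"
    by (rule det_lower_triangular[OF _ UV(2)]) (use Vij in auto)
  also have "\<dots> = (\<Prod>i<m'. c i)"
    using UV Vij by (simp add: prod_list_diag_prod lessThan_atLeast0)
  finally have dV: "det V = (\<Prod>i<m'. c i)" .
  have "det ?M = (\<Sum>i<m. ?M $$ (i, 0) * cofactor ?M i 0)"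
    using laplace_expansion_column[OF M, of 0] m by simp
  also have "\<dots> = (\<Sum>i\<in>{0, m'}. ?M $$ (i, 0) * cofactor ?M i 0)"
    by (rule sum.mono_neutral_right) (auto simp: m' cyclic_bidiagonal_def)
  also have "\<dots> = a 0 * det U + d * ((-1) ^ m' * det V)"
    using m' unfolding cofactor_def U_def V_def by (simp add: cyclic_bidiagonal_def)
  also have "\<dots> = (\<Prod>k<m. a k) + (-1) ^ (m - 1) * d * (\<Prod>k<m - 1. c k)"
    unfolding dU dV m' by (simp add: prod.lessThan_Suc_shift del: prod.lessThan_Suc)
  finally show ?thesis .
qed

text \<open>The pencil in terms of the doubled families. The sign of the corner block is that of \<open>- D\<^sub>r\<^sup>\<star>\<close>.\<close>
definition cyclic_pencil :: "nat \<Rightarrow> nat \<Rightarrow> (nat \<Rightarrow> complex mat) \<Rightarrow> (nat \<Rightarrow> complex mat) \<Rightarrow> complex poly mat" where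
  "cyclic_pencil N n L R = block_entries N n (\<lambda>k l i j.
     if l = k then [:0, L k $$ (i, j):]
     else if l = Suc k then [:R k $$ (i, j):]
     else if Suc k = N \<and> l = 0 then [:- R k $$ (i, j):] else 0)"

lemma sum_const_poly: "(\<Sum>a\<in>A. [:f a:]) = [:\<Sum>a\<in>A. f a:]"
  by (induction A rule: infinite_finite_induct) auto

lemma sum_linear_poly: "(\<Sum>a\<in>A. [:0, f a:]) = [:0, \<Sum>a\<in>A. f a:]"
  by (induction A rule: infinite_finite_induct) auto

lemma det_const_mat: "M \<in> carrier_mat n n \<Longrightarrow> det (const_mat M) = [:det M:]"
proof -
  interpret comm_ring_hom "\<lambda>a :: complex. [:a:]"
    by unfold_locales (auto simp: one_pCons)
  show ?thesis unfolding const_mat_def by (rule hom_det)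
qed

lemma cyclic_pencil_mult_left:
  assumes "\<And>k. L k \<in> carrier_mat n n" "\<And>k. R k \<in> carrier_mat n n" "\<And>k. Q k \<in> carrier_mat n n"
  shows "block_diagonal N n (\<lambda>k. const_mat (Q k)) * cyclic_pencil N n L R =
    cyclic_pencil N n (\<lambda>k. Q k * L k) (\<lambda>k. Q k * R k)"
  unfolding cyclic_pencil_def block_diagonal_mult_left
proof (rule block_entries_cong, goal_cases)
  case (1 k l i j)
  have c: "const_mat (Q k) $$ (i, a) = [:Q k $$ (i, a):]" if "a < n" for a
    using that 1 assms(3)[of k] unfolding const_mat_def by auto
  show ?case
    using 1 by (auto simp: c mult_mat_entry[OF assms(3,1)] mult_mat_entry[OF assms(3,2)] sum_const_poly sum_linear_poly sum_negf)
qed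

lemma cyclic_pencil_mult_right:
  assumes "\<And>k. L k \<in> carrier_mat n n" "\<And>k. R k \<in> carrier_mat n n" "\<And>k. Z k \<in> carrier_mat n n"
    and "Z N = Z 0"
  shows "cyclic_pencil N n L R * block_diagonal N n (\<lambda>k. const_mat (Z k)) =
    cyclic_pencil N n (\<lambda>k. L k * Z k) (\<lambda>k. R k * Z (Suc k))"
  unfolding cyclic_pencil_def block_diagonal_mult_right
proof (rule block_entries_cong, goal_cases)
  case (1 k l i j)
  have c: "const_mat (Z k) $$ (a, j) = [:Z k $$ (a, j):]" if "a < n" for a k
    using that 1 assms(3)[of k] unfolding const_mat_def by auto
  show ?case
    using 1 assms(4) by (auto simp: c mult_mat_entry[OF assms(1,3)] mult_mat_entry[OF assms(2,3)] sum_const_poly sum_linear_poly sum_negf mult.commute)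
qed

text \<open>Multiply by block diagonal matrices from both sides. The corner block acquires the factor \<open>Z\<^sub>0\<close> where the
formula for the right family asks for \<open>Z\<^sub>N\<close>, hence the hypothesis that they agree.\<close>
lemma det_cyclic_pencil_equivalence:
  assumes "\<And>k. L k \<in> carrier_mat n n" "\<And>k. R k \<in> carrier_mat n n" "\<And>k. Q k \<in> carrier_mat n n"
    and "\<And>k. Z k \<in> carrier_mat n n" "Z N = Z 0"
  shows "det (cyclic_pencil N n (\<lambda>k. Q k * L k * Z k) (\<lambda>k. Q k * R k * Z (Suc k))) =
    smult ((\<Prod>k<N. det (Q k)) * (\<Prod>k<N. det (Z k))) (det (cyclic_pencil N n L R))"
proof -
  have prod_const: "(\<Prod>k<N. [:f k:]) = [:\<Prod>k<N. f k :: complex:]" for f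
    by (induction N) (auto simp: one_pCons)
  have c: "const_mat (Q k) \<in> carrier_mat n n" "const_mat (Z k) \<in> carrier_mat n n" for k
    using assms unfolding const_mat_def by auto
  have CP: "cyclic_pencil N n L' R' \<in> carrier_mat (N * n) (N * n)" for L' R'
    unfolding cyclic_pencil_def by simp
  have "det (block_diagonal N n (\<lambda>k. const_mat (Q k)) * cyclic_pencil N n L R * block_diagonal N n (\<lambda>k. const_mat (Z k)))
      = [:\<Prod>k<N. det (Q k):] * det (cyclic_pencil N n L R) * [:\<Prod>k<N. det (Z k):]"
    using assms(3,4) c
    by (simp add: det_mult[OF mult_carrier_mat[OF block_diagonal_carrier CP] block_diagonal_carrier]
        det_mult[OF block_diagonal_carrier CP] det_block_diagonal det_const_mat[OF assms(3)] det_const_mat[OF assms(4)] prod_const)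
  moreover have "block_diagonal N n (\<lambda>k. const_mat (Q k)) * cyclic_pencil N n L R * block_diagonal N n (\<lambda>k. const_mat (Z k))
      = cyclic_pencil N n (\<lambda>k. Q k * L k * Z k) (\<lambda>k. Q k * R k * Z (Suc k))"
    unfolding cyclic_pencil_mult_left[OF assms(1-3)]
    by (rule cyclic_pencil_mult_right) (use assms in \<open>auto intro: mult_carrier_mat\<close>)
  ultimately show ?thesis by (simp add: mult.commute)
qed

text \<open>After the perfect shuffle the diagonal blocks are cyclic bidiagonal. A cycle of even length \<open>N\<close> has sign \<open>-1\<close>,
which is compensated by the sign of the corner entry.\<close>
lemma det_cyclic_pencil_triangular:
  assumes N: "even N" "N \<ge> 2" and L: "\<And>k. L k \<in> carrier_mat n n" and R: "\<And>k. R k \<in> carrier_mat n n"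
    and ut: "\<And>k. upper_triangular (L k)" "\<And>k. upper_triangular (R k)"
  shows "det (cyclic_pencil N n L R) =
    (\<Prod>i<n. monom (\<Prod>k<N. L k $$ (i, i)) N + [:\<Prod>k<N. R k $$ (i, i):])"
proof -
  let ?f = "\<lambda>k l i j. if l = k then [:0, L k $$ (i, j):]
     else if l = Suc k then [:R k $$ (i, j):]
     else if Suc k = N \<and> l = 0 then [:- R k $$ (i, j):] else 0"
  have prod_const: "(\<Prod>k<m. [:f k:]) = [:\<Prod>k<m. f k :: complex:]" for f and m :: nat
    by (induction m) (auto simp: one_pCons)
  have prod_lin: "(\<Prod>k<m. [:0, f k:]) = monom (\<Prod>k<m. f k :: complex) m" for f and m :: nat
    by (induction m) (auto simp: one_pCons monom_Suc mult_monom monom_0 monom_altdef algebra_simps)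
  have "det (cyclic_pencil N n L R) = det (block_entries n N (\<lambda>i j k l. ?f k l i j))"
    unfolding cyclic_pencil_def by (rule det_block_entries_shuffle)
  also have "\<dots> = (\<Prod>i<n. det (mat N N (\<lambda>(k, l). ?f k l i i)))"
  proof (rule det_block_entries_triangular)
    fix i j k l :: nat assume "j < i" "i < n"
    hence "L k $$ (i, j) = 0" "R k $$ (i, j) = 0"
      using upper_triangularD[OF ut(1)] upper_triangularD[OF ut(2)] L[of k] R[of k] by auto
    thus "?f k l i j = 0" by simp
  qed
  also have "\<dots> = (\<Prod>i<n. monom (\<Prod>k<N. L k $$ (i, i)) N + [:\<Prod>k<N. R k $$ (i, i):])"
  proof (rule prod.cong[OF refl])
    fix i
    obtain M where M: "N = Suc M" "odd M" using N by (cases N) auto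
    have "mat N N (\<lambda>(k, l). ?f k l i i) =
        cyclic_bidiagonal N (\<lambda>k. [:0, L k $$ (i, i):]) (\<lambda>k. [:R k $$ (i, i):]) [:- R M $$ (i, i):]"
      unfolding cyclic_bidiagonal_def by (rule eq_matI) (auto simp: M)
    also have "det \<dots> = monom (\<Prod>k<N. L k $$ (i, i)) N + [:\<Prod>k<N. R k $$ (i, i):]"
      unfolding det_cyclic_bidiagonal[OF N(2)] prod_const prod_lin using M by (simp add: mult.commute)
    finally show "det (mat N N (\<lambda>(k, l). ?f k l i i)) =
        monom (\<Prod>k<N. L k $$ (i, i)) N + [:\<Prod>k<N. R k $$ (i, i):]" .
  qed
  finally show ?thesis .
qed

section \<open>Spectra of pencils whose determinant is a product of binomials\<close>

lemma det_nonzero_iff_invertible: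
  assumes M: "M \<in> carrier_mat m m"
  shows "invertible_mat M \<longleftrightarrow> det M \<noteq> (0 :: complex)"
proof
  assume "invertible_mat M"
  then obtain B where "M * B = 1\<^sub>m (dim_row M)" "B * M = 1\<^sub>m (dim_row B)"
    unfolding invertible_mat_def inverts_mat_def by blast
  moreover from this M have "B \<in> carrier_mat m m"
    by (metis carrier_matD(1,2) carrier_matI index_mult_mat(2,3) index_one_mat(2,3))
  ultimately have "det M * det B = 1" using det_mult[OF M] M by (metis carrier_matD(1) det_one)
  thus "det M \<noteq> 0" by auto
next
  assume "det M \<noteq> 0"
  then obtain B where "B \<in> carrier_mat m m" "B * M = 1\<^sub>m m" "M * B = 1\<^sub>m m"
    using det_nonzero_inverse[OF M] by blast
  thus "invertible_mat M" using M unfolding invertible_mat_def inverts_mat_def by (auto simp: square_mat.simps)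
qed

lemma det_eval_pencil: "det (eval_pencil Q z) = poly (det Q) z"
proof -
  have "comm_ring_hom (\<lambda>p :: complex poly. poly p z)" by unfold_locales auto
  thus ?thesis unfolding eval_pencil_def by (rule comm_ring_hom.hom_det)
qed

lemma roots_unity_eq:
  assumes N: "N \<ge> 1"
  shows "roots_unity N = {z. z ^ N = 1}"
proof -
  have "{z. z ^ N = 1} = (\<lambda>k. cis (2 * pi * real k / real N)) ` {..<N}"
    using bij_betw_roots_unity[of N] N unfolding bij_betw_def by simp
  also have "\<dots> = roots_unity N"
    unfolding roots_unity_def by (auto simp: cis_conv_exp algebra_simps)
  finally show ?thesis by simp
qed

lemma complex_root_exists:
  assumes "N \<ge> 1" "z \<noteq> 0"
  shows "\<exists>w :: complex. w ^ N = z"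
proof -
  have "card {w :: complex. w ^ N = z} = N" using assms by (intro card_nth_roots) auto
  hence "{w :: complex. w ^ N = z} \<noteq> {}" using assms(1) by (intro notI) simp
  thus ?thesis by blast
qed

text \<open>The part of the spectrum that is due to one factor \<open>a \<lambda>\<^sup>N + g\<close>, including \<open>\<infinity>\<close> if the degree drops.\<close>
definition binomial_spectrum :: "nat \<Rightarrow> complex \<Rightarrow> complex \<Rightarrow> ext_complex set" where
  "binomial_spectrum N a g = {Fin z | z. a * z ^ N + g = 0} \<union> (if a = 0 then {Infty} else {})"

lemma binomial_spectrum_mem [simp]:
  "Fin z \<in> binomial_spectrum N a g \<longleftrightarrow> a * z ^ N + g = 0"
  "Infty \<in> binomial_spectrum N a g \<longleftrightarrow> a = 0"
  unfolding binomial_spectrum_def by auto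

fun ext_conj_by :: "star_kind \<Rightarrow> ext_complex \<Rightarrow> ext_complex" where
  "ext_conj_by Transp x = x"
| "ext_conj_by ConjTransp x = ext_cnj x"

lemma ext_conj_by_simps [simp]:
  "ext_conj_by s (Fin z) = Fin (conj_by s z)" "ext_conj_by s Infty = Infty"
  by (cases s; simp)+

text \<open>If all four numbers are nonzero, the \<open>N\<close>-th powers of the elements are \<open>- g / a\<close> and \<open>- g' / a'\<close>, and
reciprocity of some elements means that one of these is the inverse of the star of the other. If a coefficient
vanishes, the equation expresses that \<open>0\<close> and \<open>\<infinity>\<close> face each other.\<close>
lemma binomial_spectrum_reciprocal:
  assumes N: "N \<ge> 1" and nz: "a \<noteq> 0 \<or> g \<noteq> 0" "a' \<noteq> 0 \<or> g' \<noteq> 0"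
  shows "(\<exists>x\<in>binomial_spectrum N a g. \<exists>y\<in>binomial_spectrum N a' g'. x = ext_inverse (ext_conj_by s y)) \<longleftrightarrow>
    a * conj_by s a' = g * conj_by s g'"
proof
  assume "\<exists>x\<in>binomial_spectrum N a g. \<exists>y\<in>binomial_spectrum N a' g'. x = ext_inverse (ext_conj_by s y)"
  have N0: "(0 :: complex) ^ N = 0" using N by simp
  from \<open>\<exists>x\<in>_. _\<close> obtain y where y: "y \<in> binomial_spectrum N a' g'"
    and x: "ext_inverse (ext_conj_by s y) \<in> binomial_spectrum N a g" by blast
  show "a * conj_by s a' = g * conj_by s g'"
  proof (cases y)
    case Infty
    hence "a' = 0" "g = 0" using x y N0 by simp_all
    thus ?thesis by simp
  next
    case (Fin w)
    show ?thesis
    proof (cases "w = 0")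
      case True
      hence "g' = 0" "a = 0" using x y N0 Fin by simp_all
      thus ?thesis by simp
    next
      case False
      define v where "v = conj_by s w ^ N"
      have v: "v \<noteq> 0" using False unfolding v_def by simp
      have "a' * w ^ N + g' = 0" using y Fin by simp
      hence "conj_by s (a' * w ^ N + g') = 0" by simp
      hence 1: "conj_by s g' = - (conj_by s a' * v)" unfolding v_def by (simp add: eq_neg_iff_add_eq_0 add.commute)
      have "a * inverse (conj_by s w) ^ N + g = 0"
        using x Fin False by simp
      hence "a * inverse v + g = 0" unfolding v_def by (simp add: power_inverse)
      hence 2: "g = - (a * inverse v)" by (simp add: eq_neg_iff_add_eq_0 add.commute)
      show ?thesis unfolding 1 2 using v by simp
    qed
  qed
next
  assume eq: "a * conj_by s a' = g * conj_by s g'"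
  consider "a = 0" | "a' = 0" | "a \<noteq> 0" "a' \<noteq> 0" by blast
  thus "\<exists>x\<in>binomial_spectrum N a g. \<exists>y\<in>binomial_spectrum N a' g'. x = ext_inverse (ext_conj_by s y)"
  proof cases
    case 1
    hence "g' = 0" using eq nz by simp
    hence "Infty \<in> binomial_spectrum N a g" "Fin 0 \<in> binomial_spectrum N a' g'"
      using 1 N unfolding binomial_spectrum_def by auto
    moreover have "Infty = ext_inverse (ext_conj_by s (Fin 0))" by simp
    ultimately show ?thesis by blast
  next
    case 2
    hence "g = 0" using eq nz by simp
    hence "Fin 0 \<in> binomial_spectrum N a g" "Infty \<in> binomial_spectrum N a' g'"
      using 2 N unfolding binomial_spectrum_def by auto
    moreover have "Fin 0 = ext_inverse (ext_conj_by s Infty)" by simp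
    ultimately show ?thesis by blast
  next
    case 3
    hence g: "g \<noteq> 0" "g' \<noteq> 0" using eq by auto
    obtain w where "w ^ N = - g' / a'" using complex_root_exists[OF N, of "- g' / a'"] 3 g by auto
    hence w: "- g' / a' = w ^ N" by (rule sym)
    have w0: "w \<noteq> 0"
    proof
      assume "w = 0"
      hence "- g' / a' = 0" using w N by simp
      thus False using g 3 by simp
    qed
    have "a' * w ^ N + g' = 0" unfolding w[symmetric] using 3 by simp
    hence y: "Fin w \<in> binomial_spectrum N a' g'" unfolding binomial_spectrum_def by auto
    have "conj_by s w ^ N = conj_by s (- g' / a')" unfolding w by simp
    hence "inverse (conj_by s w) ^ N = - (conj_by s a' / conj_by s g')"
      by (simp add: power_inverse)
    hence "a * inverse (conj_by s w) ^ N + g = - (a * conj_by s a' / conj_by s g') + g" by simp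
    also have "\<dots> = 0" unfolding eq using g by simp
    finally have "Fin (inverse (conj_by s w)) \<in> binomial_spectrum N a g"
      unfolding binomial_spectrum_def by auto
    moreover have "Fin (inverse (conj_by s w)) = ext_inverse (ext_conj_by s (Fin w))" using w0 by simp
    ultimately show ?thesis using y by blast
  qed
qed

locale binomial_product_pencil =
  fixes Q :: "complex poly mat" and N n :: nat and c :: complex and \<alpha> \<gamma> :: "nat \<Rightarrow> complex"
  assumes N: "N \<ge> 1" and Q: "Q \<in> carrier_mat (N * n) (N * n)" and c: "c \<noteq> 0"
    and det: "det Q = smult c (\<Prod>i<n. monom (\<alpha> i) N + [:\<gamma> i:])"
begin

abbreviation "q i \<equiv> monom (\<alpha> i) N + [:\<gamma> i:]"

lemma q_zero: "q i = 0 \<longleftrightarrow> \<alpha> i = 0 \<and> \<gamma> i = 0"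
proof
  assume z: "q i = 0"
  have "coeff (q i) N = \<alpha> i" "coeff (q i) 0 = \<gamma> i" using N by (auto simp: coeff_pCons split: nat.splits)
  thus "\<alpha> i = 0 \<and> \<gamma> i = 0" unfolding z by simp
qed simp

lemma degree_q: "degree (q i) = (if \<alpha> i = 0 then 0 else N)"
proof (cases "\<alpha> i = 0")
  case False
  have "degree [:\<gamma> i:] < degree (monom (\<alpha> i) N)" using False N by (simp add: degree_monom_eq)
  thus ?thesis using False by (simp add: degree_add_eq_left degree_monom_eq)
qed simp

lemma poly_q: "poly (q i) z = \<alpha> i * z ^ N + \<gamma> i" by (simp add: poly_monom)

lemma regular_iff: "regular_pencil Q \<longleftrightarrow> (\<forall>i<n. \<alpha> i \<noteq> 0 \<or> \<gamma> i \<noteq> 0)"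
  unfolding regular_pencil_def det using Q c q_zero by (auto simp: square_mat.simps)

lemma Fin_spectrum: "Fin z \<in> pencil_spectrum Q \<longleftrightarrow> (\<exists>i<n. \<alpha> i * z ^ N + \<gamma> i = 0)"
proof -
  have "eval_pencil Q z \<in> carrier_mat (N * n) (N * n)" using Q unfolding eval_pencil_def by simp
  hence "Fin z \<in> pencil_spectrum Q \<longleftrightarrow> poly (det Q) z = 0"
    unfolding pencil_spectrum_def using det_nonzero_iff_invertible[of "eval_pencil Q z" "N * n"]
    by (auto simp: det_eval_pencil)
  also have "\<dots> \<longleftrightarrow> (\<exists>i<n. \<alpha> i * z ^ N + \<gamma> i = 0)"
    unfolding det using c by (auto simp: poly_prod poly_monom)
  finally show ?thesis .
qed

lemma Infty_spectrum:
  assumes "regular_pencil Q"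
  shows "Infty \<in> pencil_spectrum Q \<longleftrightarrow> (\<exists>i<n. \<alpha> i = 0)"
proof -
  have nz: "q i \<noteq> 0" if "i < n" for i using assms that unfolding regular_iff q_zero by blast
  have "degree (det Q) = (\<Sum>i<n. degree (q i))"
    unfolding det using c nz by (simp add: degree_prod_eq_sum_degree)
  also have "\<dots> = (\<Sum>i<n. if \<alpha> i = 0 then 0 else N)" by (simp only: degree_q)
  finally have d: "degree (det Q) = (\<Sum>i<n. if \<alpha> i = 0 then 0 else N)" .
  have "degree (det Q) < dim_row Q \<longleftrightarrow> (\<exists>i<n. \<alpha> i = 0)"
  proof
    assume lt: "degree (det Q) < dim_row Q"
    show "\<exists>i<n. \<alpha> i = 0"
    proof (rule ccontr)
      assume "\<not> (\<exists>i<n. \<alpha> i = 0)"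
      hence "degree (det Q) = (\<Sum>i<n. N)" unfolding d by (intro sum.cong) auto
      thus False using lt Q by simp
    qed
  next
    assume "\<exists>i<n. \<alpha> i = 0"
    hence "(\<Sum>i<n. if \<alpha> i = 0 then 0 else N) < (\<Sum>i<n. N)"
      using N by (intro sum_strict_mono_ex1) auto
    thus "degree (det Q) < dim_row Q" using d Q by (simp add: mult.commute)
  qed
  thus ?thesis unfolding pencil_spectrum_def by auto
qed

lemma spectrum_eq:
  assumes "regular_pencil Q"
  shows "pencil_spectrum Q = (\<Union>i<n. binomial_spectrum N (\<alpha> i) (\<gamma> i))"
proof -
  have "x \<in> pencil_spectrum Q \<longleftrightarrow> x \<in> (\<Union>i<n. binomial_spectrum N (\<alpha> i) (\<gamma> i))" for x
    by (cases x) (simp_all add: Fin_spectrum Infty_spectrum[OF assms] Bex_def)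
  thus ?thesis by blast
qed

text \<open>Each factor vanishing at \<open>z\<close> contributes exactly \<open>1\<close>, since the derivative of a binomial has no
nonzero roots.\<close>
lemma eigenvalue_mult_root_unity:
  assumes reg: "regular_pencil Q" and z: "z ^ N = 1"
  shows "eigenvalue_mult Q z = card {i. i < n \<and> \<gamma> i = - \<alpha> i}"
proof -
  have nz: "q i \<noteq> 0" if "i < n" for i using reg that unfolding regular_iff q_zero by blast
  have z0: "z \<noteq> 0"
  proof
    assume "z = 0"
    thus False using z N by (simp add: power_0_left)
  qed
  have ord: "order z (q i) = (if \<gamma> i = - \<alpha> i then 1 else 0)" if i: "i < n" for i
  proof (cases "\<gamma> i = - \<alpha> i")
    case False
    hence "poly (q i) z \<noteq> 0" unfolding poly_q z by (simp add: eq_neg_iff_add_eq_0 add.commute)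
    thus ?thesis using False by (simp add: order_0I)
  next
    case True
    hence a: "\<alpha> i \<noteq> 0" using nz[OF i] q_zero by auto
    have r: "poly (q i) z = 0" using poly_q[of i z] z True by simp
    have "pderiv (q i) = monom (of_nat N * \<alpha> i) (N - 1)" by (simp add: pderiv_add pderiv_monom pderiv_pCons)
    hence d: "poly (pderiv (q i)) z \<noteq> 0" using a z0 N by (simp add: poly_monom)
    have "order z (q i) = Suc (order z (pderiv (q i)))" using nz[OF i] r by (rule order_pderiv)
    thus ?thesis using True d by (simp add: order_0I)
  qed
  have "order z (\<Prod>i<m. q i) = (\<Sum>i<m. order z (q i))" if "m \<le> n" for m
    using that
  proof (induction m)
    case (Suc m)
    have "(\<Prod>i<m. q i) \<noteq> 0" "q m \<noteq> 0" using nz Suc.prems by auto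
    hence "(\<Prod>i<m. q i) * q m \<noteq> 0" by (metis mult_eq_0_iff)
    hence "order z (\<Prod>i<Suc m. q i) = order z (\<Prod>i<m. q i) + order z (q m)"
      unfolding prod.lessThan_Suc by (rule order_mult)
    thus ?case using Suc by simp
  qed simp
  from this[of n] have "order z (det Q) = (\<Sum>i<n. order z (q i))" unfolding det using c by (simp add: order_smult)
  also have "\<dots> = (\<Sum>i<n. if \<gamma> i = - \<alpha> i then 1 else 0)" using ord by simp
  also have "\<dots> = card {i. i < n \<and> \<gamma> i = - \<alpha> i}"
    by (simp add: sum.If_cases Collect_conj_eq lessThan_def)
  finally show ?thesis unfolding eigenvalue_mult_def .
qed

lemma spectral_condition_ConjTransp:
  "regular_pencil Q \<and> H_reciprocal_free (pencil_spectrum Q) \<longleftrightarrow>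
    (\<forall>i<n. \<forall>j<n. \<alpha> i * cnj (\<alpha> j) \<noteq> \<gamma> i * cnj (\<gamma> j))" (is "_ \<longleftrightarrow> ?R")
proof -
  have reg: "regular_pencil Q" if ?R
    unfolding regular_iff using that by (metis mult_zero_left)
  have "H_reciprocal_free (pencil_spectrum Q) \<longleftrightarrow> ?R" if reg: "regular_pencil Q"
  proof -
    have "\<not> H_reciprocal_free (pencil_spectrum Q) \<longleftrightarrow>
      (\<exists>i<n. \<exists>j<n. \<exists>x\<in>binomial_spectrum N (\<alpha> i) (\<gamma> i). \<exists>y\<in>binomial_spectrum N (\<alpha> j) (\<gamma> j).
         x = ext_inverse (ext_conj_by ConjTransp y))"
      unfolding H_reciprocal_free_def spectrum_eq[OF reg] by auto
    also have "\<dots> \<longleftrightarrow> (\<exists>i<n. \<exists>j<n. \<alpha> i * conj_by ConjTransp (\<alpha> j) = \<gamma> i * conj_by ConjTransp (\<gamma> j))"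
      using binomial_spectrum_reciprocal[OF N] reg unfolding regular_iff by meson
    finally show ?thesis by auto
  qed
  thus ?thesis using reg by blast
qed

text \<open>The crucial observation is that if \<open>\<alpha>\<^sub>i \<alpha>\<^sub>j = \<gamma>\<^sub>i \<gamma>\<^sub>j\<close> and one of the two factors has the roots of unity as its
roots, that is, \<open>\<gamma> = - \<alpha>\<close>, then so has the other. If \<open>i = j\<close>, this excludes \<open>\<alpha>\<^sub>i = \<gamma>\<^sub>i\<close>; if \<open>i \<noteq> j\<close>, it is
excluded by the bound on the multiplicities.\<close>
lemma spectral_condition_Transp:
  "regular_pencil Q \<and> reciprocal_free (pencil_spectrum Q - Fin ` roots_unity N) \<and>
      (\<forall>\<xi> \<in> roots_unity N. eigenvalue_mult Q \<xi> \<le> 1) \<longleftrightarrow>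
    (\<forall>i<n. \<forall>j<n. i \<noteq> j \<longrightarrow> \<alpha> i * \<alpha> j \<noteq> \<gamma> i * \<gamma> j) \<and> (\<forall>i<n. \<alpha> i \<noteq> \<gamma> i)" (is "?L \<longleftrightarrow> ?R")
proof -
  note ru = roots_unity_eq[OF N]
  have unity: "Fin z \<in> Fin ` roots_unity N \<longleftrightarrow> \<gamma> i = - \<alpha> i"
    if "Fin z \<in> binomial_spectrum N (\<alpha> i) (\<gamma> i)" "\<alpha> i \<noteq> 0" for i z
  proof -
    have "\<gamma> i = - (\<alpha> i * z ^ N)" using that unfolding binomial_spectrum_def
      by (auto simp: eq_neg_iff_add_eq_0 add.commute)
    thus ?thesis unfolding ru using that(2) by auto
  qed
  show ?thesis
  proof
    assume l: ?L
    hence reg: "regular_pencil Q" and rf: "reciprocal_free (pencil_spectrum Q - Fin ` roots_unity N)"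
      and mult: "\<And>\<xi>. \<xi> \<in> roots_unity N \<Longrightarrow> eigenvalue_mult Q \<xi> \<le> 1" by auto
    have nz: "\<alpha> i \<noteq> 0 \<or> \<gamma> i \<noteq> 0" if "i < n" for i using reg that unfolding regular_iff by blast
    have one: "i = j" if "i < n" "j < n" "\<gamma> i = - \<alpha> i" "\<gamma> j = - \<alpha> j" for i j
    proof -
      have "card {i. i < n \<and> \<gamma> i = - \<alpha> i} \<le> Suc 0"
        using mult[of 1] eigenvalue_mult_root_unity[OF reg, of 1] unfolding ru by simp
      thus ?thesis using that card_le_Suc0_iff_eq[of "{i. i < n \<and> \<gamma> i = - \<alpha> i}"] by auto
    qed
    \<comment> \<open>A violated scalar condition yields reciprocal eigenvalues, which can only be roots of unity.\<close>
    have key: "\<gamma> i = - \<alpha> i \<and> \<gamma> j = - \<alpha> j"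
      if ij: "i < n" "j < n" and eq: "\<alpha> i * \<alpha> j = \<gamma> i * \<gamma> j" for i j
    proof -
      from eq obtain x y where x: "x \<in> binomial_spectrum N (\<alpha> i) (\<gamma> i)"
        and y: "y \<in> binomial_spectrum N (\<alpha> j) (\<gamma> j)" and xy: "x = ext_inverse y"
        using binomial_spectrum_reciprocal[OF N nz[OF ij(1)] nz[OF ij(2)], of Transp] by auto
      have "x \<in> Fin ` roots_unity N \<or> y \<in> Fin ` roots_unity N"
        using rf x y xy ij unfolding reciprocal_free_def spectrum_eq[OF reg] by blast
      hence "\<gamma> i = - \<alpha> i \<and> \<alpha> i \<noteq> 0 \<or> \<gamma> j = - \<alpha> j \<and> \<alpha> j \<noteq> 0"
      proof
        assume xr: "x \<in> Fin ` roots_unity N"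
        then obtain z where z: "x = Fin z" by auto
        have "\<alpha> i \<noteq> 0" using x nz[OF ij(1)] unfolding z binomial_spectrum_def by (auto split: if_splits)
        thus ?thesis using unity x xr unfolding z by blast
      next
        assume yr: "y \<in> Fin ` roots_unity N"
        then obtain z where z: "y = Fin z" by auto
        have "\<alpha> j \<noteq> 0" using y nz[OF ij(2)] unfolding z binomial_spectrum_def by (auto split: if_splits)
        thus ?thesis using unity y yr unfolding z by blast
      qed
      thus ?thesis
      proof
        assume h: "\<gamma> i = - \<alpha> i \<and> \<alpha> i \<noteq> 0"
        hence "\<alpha> i * (\<alpha> j + \<gamma> j) = 0" using eq by (simp add: distrib_left)
        thus ?thesis using h by (simp add: eq_neg_iff_add_eq_0 add.commute)
      next
        assume h: "\<gamma> j = - \<alpha> j \<and> \<alpha> j \<noteq> 0"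
        hence "(\<alpha> i + \<gamma> i) * \<alpha> j = 0" using eq by (simp add: distrib_right)
        thus ?thesis using h by (simp add: eq_neg_iff_add_eq_0 add.commute)
      qed
    qed
    have "\<alpha> i \<noteq> \<gamma> i" if "i < n" for i
      using key[OF that that] nz[OF that] by auto
    moreover have "\<alpha> i * \<alpha> j \<noteq> \<gamma> i * \<gamma> j" if "i < n" "j < n" "i \<noteq> j" for i j
      using key[OF that(1,2)] one[OF that(1,2)] that(3) by blast
    ultimately show ?R by blast
  next
    assume R: ?R
    have nz: "\<alpha> i \<noteq> 0 \<or> \<gamma> i \<noteq> 0" if "i < n" for i using R that by metis
    hence reg: "regular_pencil Q" unfolding regular_iff by blast
    have "reciprocal_free (pencil_spectrum Q - Fin ` roots_unity N)" unfolding reciprocal_free_def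
    proof (intro ballI notI)
      fix x y assume x: "x \<in> pencil_spectrum Q - Fin ` roots_unity N"
        and y: "y \<in> pencil_spectrum Q - Fin ` roots_unity N" and xy: "x = ext_inverse y"
      obtain i j where i: "i < n" "x \<in> binomial_spectrum N (\<alpha> i) (\<gamma> i)"
        and j: "j < n" "y \<in> binomial_spectrum N (\<alpha> j) (\<gamma> j)"
        using x y unfolding spectrum_eq[OF reg] by blast
      have eq: "\<alpha> i * \<alpha> j = \<gamma> i * \<gamma> j"
        using binomial_spectrum_reciprocal[OF N nz[OF i(1)] nz[OF j(1)], of Transp] i j xy by auto
      hence "i = j" using R i j by blast
      hence "(\<alpha> i - \<gamma> i) * (\<alpha> i + \<gamma> i) = 0" using eq by (simp add: algebra_simps)
      hence g: "\<gamma> i = - \<alpha> i" using R i(1) by (simp add: eq_neg_iff_add_eq_0 add.commute)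
      hence a: "\<alpha> i \<noteq> 0" using nz[OF i(1)] by auto
      then obtain z where "x = Fin z" using i(2) unfolding binomial_spectrum_def by auto
      thus False using unity[of z i] i(2) a g x by blast
    qed
    moreover have "eigenvalue_mult Q \<xi> \<le> 1" if "\<xi> \<in> roots_unity N" for \<xi>
    proof -
      have "i = j" if "i < n" "j < n" "\<gamma> i = - \<alpha> i" "\<gamma> j = - \<alpha> j" for i j
        using R that by (metis minus_mult_minus)
      hence "card {i. i < n \<and> \<gamma> i = - \<alpha> i} \<le> Suc 0"
        using card_le_Suc0_iff_eq[of "{i. i < n \<and> \<gamma> i = - \<alpha> i}"] by auto
      thus ?thesis using eigenvalue_mult_root_unity[OF reg] that unfolding ru by simp
    qed
    ultimately show ?L using reg by blast
  qed
qed

end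

section \<open>The characterization\<close>


lemma pencil_Q_eq_cyclic_pencil:
  assumes A: "\<And>k. k \<in> {1..r} \<Longrightarrow> A k \<in> carrier_mat n n" and B: "\<And>k. k \<in> {1..r} \<Longrightarrow> B k \<in> carrier_mat n n"
    and C: "\<And>k. k \<in> {1..r} \<Longrightarrow> C k \<in> carrier_mat n n" and D: "\<And>k. k \<in> {1..r} \<Longrightarrow> D k \<in> carrier_mat n n"
  shows "pencil_Q s n r A B C D = cyclic_pencil (2 * r) n (doubled_family s r A B) (doubled_family s r C D)"
proof -
  have const: "const_mat M $$ (i, j) = [:M $$ (i, j):]" and lam: "lambda_mat M $$ (i, j) = [:0, M $$ (i, j):]"
    and neg: "(- const_mat M) $$ (i, j) = [:- M $$ (i, j):]"
    if "M \<in> carrier_mat n n" "i < n" "j < n" for M i j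
    using that unfolding lambda_mat_def const_mat_def by auto
  have blocks: "block_matrix m n F = block_entries m n (\<lambda>k l i j. F (Suc k) (Suc l) $$ (i, j))"
    for m and F :: "nat \<Rightarrow> nat \<Rightarrow> complex poly mat"
    unfolding block_matrix_def block_entries_def by simp
  show ?thesis unfolding pencil_Q_def cyclic_pencil_def blocks
  proof (rule block_entries_cong, goal_cases)
    case (1 k l i j)
    show ?case
    proof (cases "k < r")
      case True
      hence "doubled_family s r A B k = A (Suc k)" "doubled_family s r C D k = C (Suc k)"
        by (simp_all add: doubled_family_simps)
      moreover have "A (Suc k) \<in> carrier_mat n n" "C (Suc k) \<in> carrier_mat n n"
        using True by (auto intro!: A C)
      ultimately show ?thesis using True 1 by (simp add: lam const)
    next
      case False
      define t where "t = k - r"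
      have k: "k = t + r" "t < r" using False 1 unfolding t_def by auto
      have "doubled_family s r A B k = star_mat s (B (Suc t))" "doubled_family s r C D k = star_mat s (D (Suc t))"
        unfolding k(1) using k(2) by (simp_all add: doubled_family_simps)
      moreover have "star_mat s (B (Suc t)) \<in> carrier_mat n n" "star_mat s (D (Suc t)) \<in> carrier_mat n n"
        using k(2) by (auto intro!: star_mat_carrier B D)
      moreover have "star_mat s (D r) \<in> carrier_mat n n"
        using k(2) by (auto intro!: star_mat_carrier D)
      moreover have "Suc k - r = Suc t" using k by simp
      moreover have "Suc k = 2 * r \<Longrightarrow> r = Suc t" using k by simp
      ultimately show ?thesis using False 1 by (simp add: lam const neg)
    qed
  qed
qed

theorem theorem7:
  fixes s :: star_kind and n r :: nat and A B C D :: "nat \<Rightarrow> complex mat"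
  assumes "n \<ge> 1" and "r \<ge> 1"
    and "\<And>k. k \<in> {1..r} \<Longrightarrow> A k \<in> carrier_mat n n"
    and "\<And>k. k \<in> {1..r} \<Longrightarrow> B k \<in> carrier_mat n n"
    and "\<And>k. k \<in> {1..r} \<Longrightarrow> C k \<in> carrier_mat n n"
    and "\<And>k. k \<in> {1..r} \<Longrightarrow> D k \<in> carrier_mat n n"
  shows "nonsingular_system s n r A B C D \<longleftrightarrow>
    regular_pencil (pencil_Q s n r A B C D) \<and>
    (s = ConjTransp \<longrightarrow> H_reciprocal_free (pencil_spectrum (pencil_Q s n r A B C D))) \<and>
    (s = Transp \<longrightarrow>
       reciprocal_free (pencil_spectrum (pencil_Q s n r A B C D) - Fin ` roots_unity (2 * r)) \<and>
       (\<forall>\<xi> \<in> roots_unity (2 * r). eigenvalue_mult (pencil_Q s n r A B C D) \<xi> \<le> 1))"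
proof -
  let ?L = "doubled_family s r A B" and ?R = "doubled_family s r C D"
  let ?P = "pencil_Q s n r A B C D"
  interpret cyclic_pair s n r ?L ?R by (rule cyclic_pair_doubled[OF assms(2-6)])
  have N: "2 * r \<ge> 1" "2 * r \<ge> 2" "even (2 * r)" using assms(2) by auto
  have per: "periodic (2 * r) ?L" "periodic (2 * r) ?R"
    unfolding twisted_periodic_def using pL pR by blast+
  obtain Q Z where pQ: "periodic (2 * r) Q" and pZ: "periodic (2 * r) Z"
    and Q: "\<And>k. Q k \<in> carrier_mat n n" "\<And>k. det (Q k) \<noteq> 0"
    and Z: "\<And>k. Z k \<in> carrier_mat n n" "\<And>k. det (Z k) \<noteq> 0"
    and ut: "\<And>k. upper_triangular (Q k * ?L k * Z k)" "\<And>k. upper_triangular (Q k * ?R k * Z (Suc k))"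
    using periodic_Schur_form[OF N(1) per L R] by blast
  have inverses: "\<exists>Mi. periodic (2 * r) Mi \<and> (\<forall>k. Mi k \<in> carrier_mat n n \<and> Mi k * M k = 1\<^sub>m n \<and> M k * Mi k = 1\<^sub>m n)"
    if pM: "periodic (2 * r) M" and M: "\<And>k. M k \<in> carrier_mat n n" "\<And>k. det (M k) \<noteq> 0" for M :: "nat \<Rightarrow> complex mat"
  proof (rule periodic_choice)
    show "periodic (2 * r) (\<lambda>k X. X \<in> carrier_mat n n \<and> X * M k = 1\<^sub>m n \<and> M k * X = 1\<^sub>m n)"
      using pM unfolding twisted_periodic_def by simp
    show "\<exists>X. X \<in> carrier_mat n n \<and> X * M k = 1\<^sub>m n \<and> M k * X = 1\<^sub>m n" for k
      using det_nonzero_inverse[OF M(1) M(2), of k] by blast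
  qed
  obtain Qi where pQi: "periodic (2 * r) Qi"
    and Qi: "\<And>k. Qi k \<in> carrier_mat n n" "\<And>k. Qi k * Q k = 1\<^sub>m n" "\<And>k. Q k * Qi k = 1\<^sub>m n"
    using inverses[OF pQ Q] by blast
  obtain Zi where pZi: "periodic (2 * r) Zi"
    and Zi: "\<And>k. Zi k \<in> carrier_mat n n" "\<And>k. Zi k * Z k = 1\<^sub>m n" "\<And>k. Z k * Zi k = 1\<^sub>m n"
    using inverses[OF pZ Z] by blast
  define L' where "L' = (\<lambda>k. Q k * ?L k * Z k)"
  define R' where "R' = (\<lambda>k. Q k * ?R k * Z (Suc k))"
  interpret tri: triangular_cyclic_pair s n r L' R'
  proof unfold_locales
    show "L' k \<in> carrier_mat n n" "R' k \<in> carrier_mat n n" for k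
      unfolding L'_def R'_def using Q(1) Z(1) by simp_all
    show "L' (k + 2 * r) = L' k" for k
      unfolding L'_def using periodicD[OF pQ] periodicD[OF pZ] pL by simp
    show "R' (k + 2 * r) = R' k" for k
      unfolding R'_def using periodicD[OF pQ] periodicD[OF periodic_Suc[OF pZ]] pR by simp
    show "upper_triangular (L' k)" "upper_triangular (R' k)" for k
      unfolding L'_def R'_def by (rule ut)+
  qed (rule r)
  have "nonsingular_system s n r A B C D \<longleftrightarrow> doubled_nonsingular s n r ?L ?R"
    by (rule nonsingular_system_iff_doubled[OF assms(2-6)])
  also have "\<dots> \<longleftrightarrow> doubled_nonsingular s n r L' R'"
    unfolding L'_def R'_def
    by (rule equivalence_invariance[symmetric, where Qi = Qi and Zi = Zi])
      (rule Q Qi Z Zi periodicD[OF pQ] periodicD[OF pQi] periodicD[OF pZ] periodicD[OF pZi])+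
  also have "\<dots> \<longleftrightarrow> (\<forall>i<n. \<forall>j<n. tri.nondegenerate_at i j)" by (rule tri.doubled_nonsingular_iff_nondegenerate)
  finally have nonsing: "nonsingular_system s n r A B C D \<longleftrightarrow> (\<forall>i<n. \<forall>j<n. tri.nondegenerate_at i j)" .

  define c where "c = (\<Prod>k<2 * r. det (Q k)) * (\<Prod>k<2 * r. det (Z k))"
  have c: "c \<noteq> 0" unfolding c_def using Q(2) Z(2) by simp
  have pencil: "?P = cyclic_pencil (2 * r) n ?L ?R" by (rule pencil_Q_eq_cyclic_pencil[OF assms(3-6)])
  have Z0: "Z (2 * r) = Z 0" using periodicD[OF pZ, of 0] by simp
  have "smult c (det ?P) = det (cyclic_pencil (2 * r) n L' R')"
    unfolding pencil c_def L'_def R'_def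
    by (rule det_cyclic_pencil_equivalence[symmetric]) (rule L R Q Z Z0)+
  also have "\<dots> = (\<Prod>i<n. monom (tri.alpha i) (2 * r) + [:tri.gamma i:])"
    unfolding tri.alpha_def tri.gamma_def
    by (rule det_cyclic_pencil_triangular[OF N(3,2) tri.L tri.R tri.utL tri.utR])
  finally have "det ?P = smult (inverse c) (\<Prod>i<n. monom (tri.alpha i) (2 * r) + [:tri.gamma i:])"
    using c by (metis left_inverse smult_1_left smult_smult)
  moreover have "?P \<in> carrier_mat (2 * r * n) (2 * r * n)"
    unfolding pencil cyclic_pencil_def by simp
  ultimately interpret sp: binomial_product_pencil ?P "2 * r" n "inverse c" tri.alpha tri.gamma
    using N c by unfold_locales auto
  show ?thesis
  proof (cases s)
    case Transp
    have "tri.nondegenerate_at i j \<longleftrightarrow> (if i = j then tri.alpha i \<noteq> tri.gamma i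
        else tri.alpha i * tri.alpha j \<noteq> tri.gamma i * tri.gamma j)" for i j
      using tri.nondegenerate_at_offdiagonal[of i j] tri.nondegenerate_at_diagonal[of i] Transp
      by (cases "i = j") simp_all
    hence "(\<forall>i<n. \<forall>j<n. tri.nondegenerate_at i j) \<longleftrightarrow>
        (\<forall>i<n. \<forall>j<n. i \<noteq> j \<longrightarrow> tri.alpha i * tri.alpha j \<noteq> tri.gamma i * tri.gamma j) \<and>
        (\<forall>i<n. tri.alpha i \<noteq> tri.gamma i)" by auto
    thus ?thesis unfolding nonsing using sp.spectral_condition_Transp Transp by simp
  next
    case ConjTransp
    have "tri.nondegenerate_at i j \<longleftrightarrow> tri.alpha i * cnj (tri.alpha j) \<noteq> tri.gamma i * cnj (tri.gamma j)" for i j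
      using tri.nondegenerate_at_offdiagonal[of i j] tri.nondegenerate_at_diagonal[of i] ConjTransp by (cases "i = j") simp_all
    thus ?thesis unfolding nonsing using sp.spectral_condition_ConjTransp ConjTransp by simp
  qed
qed

end
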